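(* Let $N$ be the once-punctured hyperbolic torus bundle with $$\pi_1(N)=\left\langle\alpha,\beta,\tau\;\middle|\;\tau\alpha\tau^{-1}=(\beta\alpha\beta)^{-1},\ \tau\beta\tau^{-1}=\beta\alpha(\beta\alpha\beta)^{-3}\right\rangle,$$ let $\lambda=[\alpha,\beta]$, and let $\mathsf{X}_0,\mathsf{X}_1$ be the two hyperbolic curves in $\mathsf{X}(N)$. Put $l=I_\lambda$, $t=I_\tau$, $y=I_\beta$, $z=I_{\alpha\beta}$, and $\mathcal{B}_{\mathbb{C}}=\{1,z,z^2,z^3,y,zy,z^2y,z^3y\}$. For each $\epsilon\in\{0,1\}$ the set $$\mathcal{B}_{\mathbb{Q}}=\mathcal{B}_{\mathbb{C}}\cup t\,\mathcal{B}_{\mathbb{C}}$$ is a basis for $T_{\mathbb{Q}}(\mathsf{X}_\epsilon)$ as a $\mathbb{Q}[l]$-module.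
   Context: $\mathsf{X}(N)$ is the affine algebraic set of characters $\chi_\rho=\mathrm{Tr}\circ\rho$ of representations $\rho\colon\pi_1(N)\to\mathrm{SL}_2(\mathbb{C})$. A hyperbolic curve is an irreducible algebraic component of $\mathsf{X}(N)$ containing the character of a discrete faithful representation; for this $N$ there are exactly two, labelled $\mathsf{X}_0$ and $\mathsf{X}_1$. For $\gamma\in\pi_1(N)$, $I_\gamma\in\mathbb{C}[\mathsf{X}_\epsilon]$ is the regular function $I_\gamma(\chi)=\chi(\gamma)$. $T_{\mathbb{Q}}(\mathsf{X}_\epsilon)$ is the $\mathbb{Q}$-subalgebra of $\mathbb{C}[\mathsf{X}_\epsilon]$ generated by all $I_\gamma$, $\gamma\in\pi_1(N)$. Here $t\,\mathcal{B}_{\mathbb{C}}=\{tb : b\in\mathcal{B}_{\mathbb{C}}\}$. *)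

theory Defs
  imports "HOL-Analysis.Analysis" "HOL-Algebra.Group" "HOL-Algebra.Generated_Rings"
begin

section \<open>Finitely presented groups\<close>

text \<open>A letter \<open>(g, True)\<close> stands for the generator \<open>g\<close>, and \<open>(g, False)\<close> for its inverse.
  A set of pairs of words \<open>(u, v)\<close> encodes the relations \<open>u = v\<close>.\<close>

type_synonym 'g word = "('g \<times> bool) list"

definition winv :: "'g word \<Rightarrow> 'g word" where
  "winv w = rev (map (\<lambda>(g, b). (g, \<not> b)) w)"

inductive word_eq :: "('g word \<times> 'g word) set \<Rightarrow> 'g word \<Rightarrow> 'g word \<Rightarrow> bool" for R where
  refl:   "word_eq R w w"
| sym:    "word_eq R u v \<Longrightarrow> word_eq R v u"
| trans:  "word_eq R u v \<Longrightarrow> word_eq R v w \<Longrightarrow> word_eq R u w"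
| cong:   "word_eq R u v \<Longrightarrow> word_eq R u' v' \<Longrightarrow> word_eq R (u @ u') (v @ v')"
| cancel: "word_eq R [(g, b), (g, \<not> b)] []"
| rel:    "(u, v) \<in> R \<Longrightarrow> word_eq R u v"

definition word_class :: "('g word \<times> 'g word) set \<Rightarrow> 'g word \<Rightarrow> 'g word set" where
  "word_class R w = {v. word_eq R w v}"

definition presented_group :: "('g word \<times> 'g word) set \<Rightarrow> 'g word set monoid" where
  "presented_group R =
     \<lparr>carrier = range (word_class R),
      mult = (\<lambda>C D. \<Union>u\<in>C. \<Union>v\<in>D. word_class R (u @ v)),
      one = word_class R []\<rparr>"

lemma word_class_eq_iff: "word_class R u = word_class R v \<longleftrightarrow> word_eq R u v"
proof
  assume "word_class R u = word_class R v"
  then have "v \<in> word_class R u" by (simp add: word_class_def word_eq.refl)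
  then show "word_eq R u v" by (simp add: word_class_def)
next
  assume uv: "word_eq R u v"
  show "word_class R u = word_class R v"
    unfolding word_class_def
    using word_eq.trans[OF uv] word_eq.trans[OF word_eq.sym[OF uv]] by auto
qed

lemma presented_group_mult:
  "word_class R u \<otimes>\<^bsub>presented_group R\<^esub> word_class R v = word_class R (u @ v)"
proof -
  have "word_class R (u' @ v') = word_class R (u @ v)"
    if "u' \<in> word_class R u" "v' \<in> word_class R v" for u' v'
  proof -
    have "word_eq R u u'" "word_eq R v v'"
      using that by (simp_all add: word_class_def)
    then show ?thesis
      unfolding word_class_eq_iff by (rule word_eq.sym[OF word_eq.cong])
  qed
  moreover have "u \<in> word_class R u" "v \<in> word_class R v"
    by (simp_all add: word_class_def word_eq.refl)
  ultimately have "(\<Union>u'\<in>word_class R u. \<Union>v'\<in>word_class R v. word_class R (u' @ v'))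
      = word_class R (u @ v)"
    by blast
  then show ?thesis
    by (simp add: presented_group_def)
qed

lemma word_eq_winv_left: "word_eq R (winv w @ w) []"
proof (induction w)
  case Nil
  then show ?case by (simp add: winv_def word_eq.refl)
next
  case (Cons a w)
  obtain g b where a: "a = (g, b)" by (cases a)
  have "word_eq R ([(g, \<not> b), (g, b)] @ w) ([] @ w)"
    using word_eq.cancel[of R g "\<not> b"] by (intro word_eq.cong word_eq.refl) simp
  then have "word_eq R (winv w @ ([(g, \<not> b), (g, b)] @ w)) (winv w @ w)"
    using word_eq.cong[OF word_eq.refl] by simp
  from word_eq.trans[OF this Cons.IH] show ?case
    by (simp add: a winv_def)
qed

lemma group_presented_group: "group (presented_group R)"
proof (rule groupI)
  fix x assume "x \<in> carrier (presented_group R)"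
  then obtain w where w: "x = word_class R w" by (auto simp: presented_group_def)
  show "\<exists>y\<in>carrier (presented_group R). y \<otimes>\<^bsub>presented_group R\<^esub> x = \<one>\<^bsub>presented_group R\<^esub>"
  proof
    show "word_class R (winv w) \<otimes>\<^bsub>presented_group R\<^esub> x = \<one>\<^bsub>presented_group R\<^esub>"
      using word_eq_winv_left[of R w]
      by (simp add: w presented_group_mult) (simp add: presented_group_def word_class_eq_iff)
  qed (simp add: presented_group_def)
next
  fix x assume "x \<in> carrier (presented_group R)"
  then obtain w where w: "x = word_class R w" by (auto simp: presented_group_def)
  have "\<one>\<^bsub>presented_group R\<^esub> = word_class R []" by (simp add: presented_group_def)
  then show "\<one>\<^bsub>presented_group R\<^esub> \<otimes>\<^bsub>presented_group R\<^esub> x = x"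
    by (simp add: w presented_group_mult)
next
  fix x y assume "x \<in> carrier (presented_group R)" "y \<in> carrier (presented_group R)"
  then obtain u v where "x = word_class R u" "y = word_class R v"
    by (auto simp: presented_group_def)
  then show "x \<otimes>\<^bsub>presented_group R\<^esub> y \<in> carrier (presented_group R)"
    by (simp add: presented_group_mult) (simp add: presented_group_def)
next
  fix x y z assume "x \<in> carrier (presented_group R)" "y \<in> carrier (presented_group R)"
    "z \<in> carrier (presented_group R)"
  then obtain u v w where "x = word_class R u" "y = word_class R v" "z = word_class R w"
    by (auto simp: presented_group_def)
  then show "x \<otimes>\<^bsub>presented_group R\<^esub> y \<otimes>\<^bsub>presented_group R\<^esub> z =
      x \<otimes>\<^bsub>presented_group R\<^esub> (y \<otimes>\<^bsub>presented_group R\<^esub> z)"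
    by (simp add: presented_group_mult)
qed (simp add: presented_group_def)


section \<open>The fundamental group of the torus bundle\<close>

datatype gen = GA | GB | GT

definition wa :: "gen word" where "wa = [(GA, True)]"
definition wb :: "gen word" where "wb = [(GB, True)]"
definition wt :: "gen word" where "wt = [(GT, True)]"

definition relN :: "(gen word \<times> gen word) set" where
  "relN = (let c = winv (wb @ wa @ wb) in
     {(wt @ wa @ winv wt, c),
      (wt @ wb @ winv wt, wb @ wa @ c @ c @ c)})"

definition piN :: "gen word set monoid" where
  "piN = presented_group relN"

definition \<alpha>N :: "gen word set" where "\<alpha>N = word_class relN wa"
definition \<beta>N :: "gen word set" where "\<beta>N = word_class relN wb"
definition \<tau>N :: "gen word set" where "\<tau>N = word_class relN wt"

definition lamN :: "gen word set" where
  "lamN = \<alpha>N \<otimes>\<^bsub>piN\<^esub> \<beta>N \<otimes>\<^bsub>piN\<^esub> inv\<^bsub>piN\<^esub> \<alpha>N \<otimes>\<^bsub>piN\<^esub> inv\<^bsub>piN\<^esub> \<beta>N"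

lemma group_piN: "group piN"
  unfolding piN_def by (rule group_presented_group)

lemma generators_in_piN: "\<alpha>N \<in> carrier piN" "\<beta>N \<in> carrier piN" "\<tau>N \<in> carrier piN"
  by (auto simp: \<alpha>N_def \<beta>N_def \<tau>N_def piN_def presented_group_def)

lemma inv_word_class: "inv\<^bsub>piN\<^esub> word_class relN w = word_class relN (winv w)"
proof (rule group.inv_equality[OF group_piN])
  show "word_class relN (winv w) \<otimes>\<^bsub>piN\<^esub> word_class relN w = \<one>\<^bsub>piN\<^esub>"
    using word_eq_winv_left[of relN w]
    by (simp add: piN_def presented_group_mult) (simp add: presented_group_def word_class_eq_iff)
qed (auto simp: piN_def presented_group_def)

lemma piN_relations:
  "\<tau>N \<otimes>\<^bsub>piN\<^esub> \<alpha>N \<otimes>\<^bsub>piN\<^esub> inv\<^bsub>piN\<^esub> \<tau>N = inv\<^bsub>piN\<^esub> (\<beta>N \<otimes>\<^bsub>piN\<^esub> \<alpha>N \<otimes>\<^bsub>piN\<^esub> \<beta>N)"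
  "\<tau>N \<otimes>\<^bsub>piN\<^esub> \<beta>N \<otimes>\<^bsub>piN\<^esub> inv\<^bsub>piN\<^esub> \<tau>N
     = \<beta>N \<otimes>\<^bsub>piN\<^esub> \<alpha>N \<otimes>\<^bsub>piN\<^esub> (inv\<^bsub>piN\<^esub> (\<beta>N \<otimes>\<^bsub>piN\<^esub> \<alpha>N \<otimes>\<^bsub>piN\<^esub> \<beta>N) [^]\<^bsub>piN\<^esub> (3::nat))"
proof -
  interpret group piN by (rule group_piN)
  have mult: "word_class relN u \<otimes>\<^bsub>piN\<^esub> word_class relN v = word_class relN (u @ v)" for u v
    by (simp add: piN_def presented_group_mult)
  have cls: "word_class relN u \<in> carrier piN" for u
    by (simp add: piN_def presented_group_def)
  have pow: "word_class relN u [^]\<^bsub>piN\<^esub> (3::nat) = word_class relN (u @ u @ u)" for u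
    by (simp add: numeral_3_eq_3 mult cls)
  have "word_eq relN (wt @ wa @ winv wt) (winv (wb @ wa @ wb))"
    by (rule word_eq.rel) (simp add: relN_def Let_def)
  then show "\<tau>N \<otimes>\<^bsub>piN\<^esub> \<alpha>N \<otimes>\<^bsub>piN\<^esub> inv\<^bsub>piN\<^esub> \<tau>N = inv\<^bsub>piN\<^esub> (\<beta>N \<otimes>\<^bsub>piN\<^esub> \<alpha>N \<otimes>\<^bsub>piN\<^esub> \<beta>N)"
    by (simp add: \<alpha>N_def \<beta>N_def \<tau>N_def inv_word_class mult word_class_eq_iff)
  have "word_eq relN (wt @ wb @ winv wt)
      (wb @ wa @ winv (wb @ wa @ wb) @ winv (wb @ wa @ wb) @ winv (wb @ wa @ wb))"
    by (rule word_eq.rel) (simp add: relN_def Let_def)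
  then show "\<tau>N \<otimes>\<^bsub>piN\<^esub> \<beta>N \<otimes>\<^bsub>piN\<^esub> inv\<^bsub>piN\<^esub> \<tau>N
     = \<beta>N \<otimes>\<^bsub>piN\<^esub> \<alpha>N \<otimes>\<^bsub>piN\<^esub> (inv\<^bsub>piN\<^esub> (\<beta>N \<otimes>\<^bsub>piN\<^esub> \<alpha>N \<otimes>\<^bsub>piN\<^esub> \<beta>N) [^]\<^bsub>piN\<^esub> (3::nat))"
    by (simp add: \<alpha>N_def \<beta>N_def \<tau>N_def inv_word_class mult pow word_class_eq_iff)
qed


section \<open>Characters\<close>

definition SL2C :: "(complex^2^2) monoid" where
  "SL2C = \<lparr>carrier = {A. det A = 1}, mult = (**), one = mat 1\<rparr>"

lemma group_SL2C: "group SL2C"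
proof (rule groupI)
  fix A assume "A \<in> carrier SL2C"
  then have d: "det A = 1" by (simp add: SL2C_def)
  then have "invertible A" by (simp add: invertible_det_nz)
  then obtain B where B: "B ** A = mat 1" by (auto simp: invertible_def)
  then have "det B * det A = 1" by (metis det_I det_mul)
  with B d show "\<exists>B\<in>carrier SL2C. B \<otimes>\<^bsub>SL2C\<^esub> A = \<one>\<^bsub>SL2C\<^esub>"
    by (auto simp: SL2C_def)
qed (auto simp: SL2C_def det_mul matrix_mul_assoc)

text \<open>A character is a function on the carrier of the group; its values elsewhere are fixed, so that
  equality of characters is equality on the group.\<close>

type_synonym char_fun = "gen word set \<Rightarrow> complex"

definition character :: "(gen word set \<Rightarrow> complex^2^2) \<Rightarrow> char_fun" where
  "character \<rho> = (\<lambda>\<gamma>\<in>carrier piN. trace (\<rho> \<gamma>))"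

definition XN :: "char_fun set" where
  "XN = character ` hom piN SL2C"

definition discrete_faithful :: "(gen word set \<Rightarrow> complex^2^2) \<Rightarrow> bool" where
  "discrete_faithful \<rho> \<longleftrightarrow>
     \<rho> \<in> hom piN SL2C \<and> inj_on \<rho> (carrier piN) \<and> discrete (\<rho> ` carrier piN)"


section \<open>Algebras of functions and the Zariski topology\<close>

definition fun_ring :: "'x set \<Rightarrow> ('x \<Rightarrow> complex) ring" where
  "fun_ring X =
     \<lparr>carrier = X \<rightarrow>\<^sub>E UNIV,
      mult = (\<lambda>f g. \<lambda>x\<in>X. f x * g x),
      one = (\<lambda>x\<in>X. 1),
      zero = (\<lambda>x\<in>X. 0),
      add = (\<lambda>f g. \<lambda>x\<in>X. f x + g x)\<rparr>"

lemma fun_ring_simps: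
  "f \<in> carrier (fun_ring X) \<longleftrightarrow> f \<in> extensional X"
  "f \<otimes>\<^bsub>fun_ring X\<^esub> g = (\<lambda>x\<in>X. f x * g x)"
  "f \<oplus>\<^bsub>fun_ring X\<^esub> g = (\<lambda>x\<in>X. f x + g x)"
  "\<one>\<^bsub>fun_ring X\<^esub> = (\<lambda>x\<in>X. 1)"
  "\<zero>\<^bsub>fun_ring X\<^esub> = (\<lambda>x\<in>X. 0)"
  by (simp_all add: fun_ring_def PiE_def)

lemma cring_fun_ring: "cring (fun_ring X)"
proof (rule cringI)
  show "abelian_group (fun_ring X)"
  proof (rule abelian_groupI)
    fix f assume "f \<in> carrier (fun_ring X)"
    show "\<exists>g\<in>carrier (fun_ring X). g \<oplus>\<^bsub>fun_ring X\<^esub> f = \<zero>\<^bsub>fun_ring X\<^esub>"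
      by (rule bexI[of _ "\<lambda>x\<in>X. - f x"])
        (auto simp: fun_ring_simps intro!: restrict_ext)
  next
    fix f assume "f \<in> carrier (fun_ring X)"
    then show "\<zero>\<^bsub>fun_ring X\<^esub> \<oplus>\<^bsub>fun_ring X\<^esub> f = f"
      by (auto simp: fun_ring_simps intro: extensionalityI[of _ X])
  qed (auto simp: fun_ring_simps ac_simps intro!: restrict_ext)
next
  show "Group.comm_monoid (fun_ring X)"
  proof (rule comm_monoidI)
    fix f assume "f \<in> carrier (fun_ring X)"
    then show "\<one>\<^bsub>fun_ring X\<^esub> \<otimes>\<^bsub>fun_ring X\<^esub> f = f"
      by (auto simp: fun_ring_simps intro: extensionalityI[of _ X])
  qed (auto simp: fun_ring_simps ac_simps intro!: restrict_ext)
qed (auto simp: fun_ring_simps ring_distribs intro!: restrict_ext)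

text \<open>For a subfield \<open>K\<close> of the complex numbers, this is the \<open>K\<close>-algebra of functions on \<open>X\<close>
  generated by \<open>S\<close>: the subring generated by \<open>S\<close> and the constant functions with values in \<open>K\<close>.\<close>

definition gen_algebra :: "'x set \<Rightarrow> complex set \<Rightarrow> ('x \<Rightarrow> complex) set \<Rightarrow> ('x \<Rightarrow> complex) set" where
  "gen_algebra X K S = generate_ring (fun_ring X) ((\<lambda>c. \<lambda>x\<in>X. c) ` K \<union> S)"

definition Ifun :: "char_fun set \<Rightarrow> gen word set \<Rightarrow> (char_fun \<Rightarrow> complex)" where
  "Ifun X \<gamma> = (\<lambda>\<psi>\<in>X. \<psi> \<gamma>)"

text \<open>The coordinate ring of the algebraic set \<open>XN\<close> is generated by the functions \<open>Ifun XN \<gamma>\<close>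
  (finitely many of them suffice and give the embedding of \<open>XN\<close> in an affine space), so the
  Zariski closed subsets of \<open>XN\<close> are the common zero sets of families of polynomials in these.\<close>

definition zariski_closed :: "char_fun set \<Rightarrow> bool" where
  "zariski_closed Z \<longleftrightarrow>
     (\<exists>F \<subseteq> gen_algebra XN UNIV (Ifun XN ` carrier piN). Z = {\<psi> \<in> XN. \<forall>f\<in>F. f \<psi> = 0})"

definition zariski_irreducible :: "char_fun set \<Rightarrow> bool" where
  "zariski_irreducible Z \<longleftrightarrow> Z \<noteq> {} \<and>
     (\<forall>A B. zariski_closed A \<longrightarrow> zariski_closed B \<longrightarrow> Z \<subseteq> A \<union> B \<longrightarrow> Z \<subseteq> A \<or> Z \<subseteq> B)"

definition irreducible_component :: "char_fun set \<Rightarrow> bool" where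
  "irreducible_component Z \<longleftrightarrow> zariski_closed Z \<and> zariski_irreducible Z \<and>
     (\<forall>Z'. zariski_closed Z' \<longrightarrow> zariski_irreducible Z' \<longrightarrow> Z \<subseteq> Z' \<longrightarrow> Z' = Z)"

definition hyperbolic_curve :: "char_fun set \<Rightarrow> bool" where
  "hyperbolic_curve X \<longleftrightarrow>
     irreducible_component X \<and> (\<exists>\<rho>. discrete_faithful \<rho> \<and> character \<rho> \<in> X)"

definition T_Q :: "char_fun set \<Rightarrow> (char_fun \<Rightarrow> complex) set" where
  "T_Q X = gen_algebra X \<rat> (Ifun X ` carrier piN)"


section \<open>Bases of modules over a subring\<close>

text \<open>\<open>K\<close> is a subring of the commutative ring \<open>R\<close>, and \<open>M\<close> is a \<open>K\<close>-submodule of \<open>R\<close>.\<close>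

definition module_basis :: "('a, 'm) ring_scheme \<Rightarrow> 'a set \<Rightarrow> 'a set \<Rightarrow> 'a set \<Rightarrow> bool" where
  "module_basis R K M B \<longleftrightarrow>
     B \<subseteq> M \<and>
     M = {\<Oplus>\<^bsub>R\<^esub>b\<in>A. c b \<otimes>\<^bsub>R\<^esub> b | A c. finite A \<and> A \<subseteq> B \<and> c \<in> A \<rightarrow> K} \<and>
     (\<forall>A c. finite A \<longrightarrow> A \<subseteq> B \<longrightarrow> c \<in> A \<rightarrow> K \<longrightarrow>
        (\<Oplus>\<^bsub>R\<^esub>b\<in>A. c b \<otimes>\<^bsub>R\<^esub> b) = \<zero>\<^bsub>R\<^esub> \<longrightarrow> (\<forall>b\<in>A. c b = \<zero>\<^bsub>R\<^esub>))"

end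

theory Submission
  imports Defs
begin

text \<open>Write \<open>x, y, z, t\<close> for the traces of \<open>\<alpha>, \<beta>, \<alpha>\<beta>, \<tau>\<close>. Invariance of the characters of the fibre
  group under the monodromy forces \<open>x = y * z / 2\<close> and \<open>y = 0\<close> or \<open>z\<^sup>2 * (y\<^sup>2 - 2) = 8\<close>. The
  degenerate characters, with \<open>y = 0\<close> or \<open>z\<^sup>2 = 4\<close>, cannot come from a faithful representation:
  there \<open>\<beta>\<^sup>4 = 1\<close>, respectively \<open>\<alpha>\<close> and \<open>\<beta>\<close> commute. Elsewhere the trace identity for
  the commutator of \<open>\<tau>\<close> and \<open>\<alpha>\<close> yields \<open>t\<^sup>2 = - (z ^ 4) / 4\<close>, so a hyperbolic curve is one of the
  two sets of characters with \<open>t = \<omega> * z\<^sup>2 / 2\<close>, \<open>\<omega> = \<plusminus>\<i>\<close>. Each of them is a copy of the rational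
  curve \<open>z\<^sup>2 * (y\<^sup>2 - 2) = 8\<close>, on which every \<open>I\<^sub>\<gamma>\<close> is a polynomial in \<open>z, y\<close> over \<open>\<rat>(\<omega>)\<close>.

  There \<open>l = y\<^sup>2 - 4 + z\<^sup>2 / 2\<close> and \<open>z ^ 4 = 2 * (l + 2) * z\<^sup>2 - 16\<close>. Thus \<open>z\<close> is a unit over
  \<open>\<rat>[l]\<close>, which puts \<open>\<omega>\<close> in the span of the proposed basis. Conversely, at real points of the
  curve a rational relation splits into real and imaginary parts (that is, into the coefficients of
  \<open>1\<close> and \<open>t\<close>), then by the signs of \<open>z\<close> and \<open>y\<close>, and finally by exchanging the two values of
  \<open>z\<^sup>2\<close>, with product 16, that share the same \<open>l\<close>.\<close>

section \<open>Two by two matrices\<close>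

text \<open>A type of its own makes the matrix product the multiplication of a
  \<open>ring_1\<close>, so that ring rewriting applies to it; \<open>of_mat\<close> and
  \<open>to_mat\<close> translate between it and \<open>complex^2^2\<close>.\<close>

datatype mat2 = Mat2 (e11: complex) (e12: complex) (e21: complex) (e22: complex)

instantiation mat2 :: ring_1
begin

definition "0 = Mat2 0 0 0 0"
definition "1 = Mat2 1 0 0 1"
definition "A + B = Mat2 (e11 A + e11 B) (e12 A + e12 B) (e21 A + e21 B) (e22 A + e22 B)"
definition "A - B = Mat2 (e11 A - e11 B) (e12 A - e12 B) (e21 A - e21 B) (e22 A - e22 B)"
definition "- A = Mat2 (- e11 A) (- e12 A) (- e21 A) (- e22 A)"
definition "A * B = Mat2 (e11 A * e11 B + e12 A * e21 B) (e11 A * e12 B + e12 A * e22 B)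
  (e21 A * e11 B + e22 A * e21 B) (e21 A * e12 B + e22 A * e22 B)"

instance
  by standard
    (simp_all add: zero_mat2_def one_mat2_def plus_mat2_def minus_mat2_def uminus_mat2_def
      times_mat2_def mat2.expand algebra_simps)

end

lemmas mat2_defs = zero_mat2_def one_mat2_def plus_mat2_def minus_mat2_def uminus_mat2_def
  times_mat2_def

definition tr2 :: "mat2 \<Rightarrow> complex" where "tr2 A = e11 A + e22 A"
definition det2 :: "mat2 \<Rightarrow> complex" where "det2 A = e11 A * e22 A - e12 A * e21 A"
text \<open>The adjugate is the inverse when the determinant is 1, but it is polynomial in the
  entries and reverses products without any hypothesis.\<close>

definition adj2 :: "mat2 \<Rightarrow> mat2" where "adj2 A = Mat2 (e22 A) (- e12 A) (- e21 A) (e11 A)"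
definition scale2 :: "complex \<Rightarrow> mat2 \<Rightarrow> mat2" where
  "scale2 c A = Mat2 (c * e11 A) (c * e12 A) (c * e21 A) (c * e22 A)"

lemma scale2_simps [simp]:
  "A * scale2 c B = scale2 c (A * B)" "scale2 c A * B = scale2 c (A * B)"
  "scale2 c (scale2 d A) = scale2 (c * d) A" "scale2 1 A = A" "scale2 0 A = 0" "scale2 c 0 = 0"
  by (simp_all add: scale2_def mat2_defs mat2.expand algebra_simps)

lemma scale2_distrib:
  "scale2 c (A + B) = scale2 c A + scale2 c B" "scale2 c (A - B) = scale2 c A - scale2 c B"
  "scale2 (c + d) A = scale2 c A + scale2 d A" "scale2 (c - d) A = scale2 c A - scale2 d A"
  by (simp_all add: scale2_def mat2_defs algebra_simps)

lemma tr2_simps: "tr2 (A + B) = tr2 A + tr2 B" "tr2 (A - B) = tr2 A - tr2 B" "tr2 (- A) = - tr2 A"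
  "tr2 (scale2 c A) = c * tr2 A" "tr2 1 = 2" "tr2 0 = 0"
  by (simp_all add: tr2_def scale2_def mat2_defs algebra_simps)

lemma tr2_mult_commute: "tr2 (A * B) = tr2 (B * A)"
  by (simp add: tr2_def mat2_defs algebra_simps)

lemma tr2_adj2 [simp]: "tr2 (adj2 A) = tr2 A"
  by (simp add: tr2_def adj2_def)

lemma det2_mult: "det2 (A * B) = det2 A * det2 B"
  by (simp add: det2_def mat2_defs algebra_simps)

lemma det2_adj2 [simp]: "det2 (adj2 A) = det2 A"
  by (simp add: det2_def adj2_def algebra_simps)

lemma det2_one [simp]: "det2 1 = 1"
  by (simp add: det2_def mat2_defs)

lemma adj2_adj2 [simp]: "adj2 (adj2 A) = A"
  by (simp add: adj2_def)

lemma adj2_mult: "adj2 (A * B) = adj2 B * adj2 A"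
  by (simp add: adj2_def mat2_defs algebra_simps)

lemma adj2_one [simp]: "adj2 1 = 1"
  by (simp add: adj2_def mat2_defs)

lemma adj2_eq: "adj2 A = scale2 (tr2 A) 1 - A"
  by (simp add: adj2_def scale2_def tr2_def mat2_defs)

lemma mult_adj2: "A * adj2 A = scale2 (det2 A) 1" "adj2 A * A = scale2 (det2 A) 1"
  by (simp_all add: adj2_def scale2_def det2_def mat2_defs algebra_simps)

lemma sl2_inverse:
  assumes "det2 A = 1"
  shows "A * adj2 A = 1" "adj2 A * A = 1" "A * (adj2 A * B) = B" "adj2 A * (A * B) = B"
  using assms by (simp_all add: mult_adj2 mult.assoc[symmetric])

text \<open>Cayley-Hamilton, the source of the later reductions of repeated letters.\<close>

lemma sl2_square:
  assumes "det2 A = 1"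
  shows "A * A = scale2 (tr2 A) A - 1"
proof -
  have "A * A = scale2 (tr2 A) A - scale2 (det2 A) 1"
    by (simp add: scale2_def tr2_def det2_def mat2_defs algebra_simps)
  with assms show ?thesis by simp
qed

text \<open>Fricke's trace formula.\<close>

lemma tr2_commutator:
  assumes "det2 A = 1" "det2 B = 1"
  shows "tr2 (A * B * adj2 A * adj2 B) =
    (tr2 A)\<^sup>2 + (tr2 B)\<^sup>2 + (tr2 (A * B))\<^sup>2 - tr2 A * tr2 B * tr2 (A * B) - 2"
proof -
  \<comment> \<open>With the determinants kept as factors this is a polynomial identity in the eight
    entries.\<close>
  have "tr2 (A * B * adj2 A * adj2 B) = (tr2 A)\<^sup>2 * det2 B + (tr2 B)\<^sup>2 * det2 A
      + (tr2 (A * B))\<^sup>2 - tr2 A * tr2 B * tr2 (A * B) - 2 * det2 A * det2 B"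
    by (simp add: tr2_def det2_def adj2_def mat2_defs power2_eq_square algebra_simps)
  with assms show ?thesis by simp
qed

section \<open>Representations as triples of matrices\<close>

definition letter :: "mat2 \<Rightarrow> mat2 \<Rightarrow> mat2 \<Rightarrow> gen \<times> bool \<Rightarrow> mat2" where
  "letter A B T = (\<lambda>(g, b). let M = (case g of GA \<Rightarrow> A | GB \<Rightarrow> B | GT \<Rightarrow> T)
     in if b then M else adj2 M)"

definition weval :: "mat2 \<Rightarrow> mat2 \<Rightarrow> mat2 \<Rightarrow> gen word \<Rightarrow> mat2" where
  "weval A B T w = foldr (\<lambda>p M. letter A B T p * M) w 1"

lemma weval_simps [simp]:
  "weval A B T [] = 1" "weval A B T (p # w) = letter A B T p * weval A B T w"
  by (simp_all add: weval_def)

lemma weval_append [simp]: "weval A B T (u @ v) = weval A B T u * weval A B T v"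
  by (induction u) (simp_all add: mult.assoc)

lemma letter_simps [simp]: "letter A B T (GA, b) = (if b then A else adj2 A)"
  "letter A B T (GB, b) = (if b then B else adj2 B)"
  "letter A B T (GT, b) = (if b then T else adj2 T)"
  by (simp_all add: letter_def)

lemma adj2_letter: "adj2 (letter A B T (g, b)) = letter A B T (g, \<not> b)"
  by (simp add: letter_def Let_def)

lemma weval_winv: "weval A B T (winv w) = adj2 (weval A B T w)"
  by (induction w) (auto simp: winv_def adj2_mult adj2_letter)

lemma weval_generators [simp]: "weval A B T wa = A" "weval A B T wb = B" "weval A B T wt = T"
  by (simp_all add: wa_def wb_def wt_def)

definition is_rep :: "mat2 \<Rightarrow> mat2 \<Rightarrow> mat2 \<Rightarrow> bool" where
  "is_rep A B T \<longleftrightarrow> det2 A = 1 \<and> det2 B = 1 \<and> det2 T = 1 \<and>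
     (\<forall>(u, v)\<in>relN. weval A B T u = weval A B T v)"

lemma det2_weval:
  assumes "is_rep A B T"
  shows "det2 (weval A B T w) = 1"
proof (induction w)
  case (Cons p w)
  have "det2 (letter A B T p) = 1"
    using assms by (cases p; cases "fst p") (auto simp: is_rep_def)
  with Cons show ?case by (simp add: det2_mult)
qed simp

lemma weval_cong:
  assumes "is_rep A B T" and "word_eq relN u v"
  shows "weval A B T u = weval A B T v"
  using assms(2)
proof (induction rule: word_eq.induct)
  case (cancel g b)
  have "det2 (letter A B T (g, b)) = 1"
    using det2_weval[OF assms(1), of "[(g, b)]"] by (simp add: weval_def)
  then show ?case by (simp add: adj2_letter[symmetric] sl2_inverse)
next
  case (rel u v)
  with assms(1) show ?case by (auto simp: is_rep_def)
qed simp_all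

definition of_mat :: "complex^2^2 \<Rightarrow> mat2" where
  "of_mat M = Mat2 (M$1$1) (M$1$2) (M$2$1) (M$2$2)"

definition to_mat :: "mat2 \<Rightarrow> complex^2^2" where
  "to_mat A = vector [vector [e11 A, e12 A], vector [e21 A, e22 A]]"

lemma of_to_mat [simp]: "of_mat (to_mat A) = A"
  by (simp add: of_mat_def to_mat_def)

lemma of_mat_eq_iff: "of_mat M = of_mat N \<longleftrightarrow> M = N"
  by (auto simp: of_mat_def vec_eq_iff forall_2)

lemma of_mat_simps:
  "of_mat (M ** N) = of_mat M * of_mat N" "of_mat (mat 1) = 1"
  "det M = det2 (of_mat M)" "trace M = tr2 (of_mat M)"
  by (simp_all add: of_mat_def mat2_defs matrix_matrix_mult_def sum_2 mat_def det_2 det2_def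
      trace_def tr2_def)

lemma hom_weval:
  assumes hom: "\<rho> \<in> hom piN SL2C"
  obtains A B T where "is_rep A B T" "\<And>w. of_mat (\<rho> (word_class relN w)) = weval A B T w"
proof -
  have cls: "word_class relN w \<in> carrier piN" for w
    by (simp add: piN_def presented_group_def)
  have mult: "word_class relN u \<otimes>\<^bsub>piN\<^esub> word_class relN v = word_class relN (u @ v)" for u v
    by (simp add: piN_def presented_group_mult)
  define f where "f w = of_mat (\<rho> (word_class relN w))" for w
  have f_append: "f (u @ v) = f u * f v" for u v
    using hom_mult[OF hom cls cls, of u v] by (simp add: f_def mult of_mat_simps SL2C_def)
  have f_det: "det2 (f w) = 1" for w
    using hom_in_carrier[OF hom cls] by (simp add: f_def of_mat_simps SL2C_def)
  \<comment> \<open>\<open>hom\<close> asks only for compatibility with products; the unit is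
    preserved because an idempotent of determinant 1 is the identity.\<close>
  have f_Nil: "f [] = 1"
  proof -
    have "f [] * f [] = f []" using f_append[of "[]" "[]"] by simp
    then have "adj2 (f []) * (f [] * f []) = adj2 (f []) * f []" by simp
    then show ?thesis by (simp add: sl2_inverse f_det)
  qed
  have f_cong: "f u = f v" if "word_eq relN u v" for u v
    using that by (simp add: f_def word_class_eq_iff[symmetric])
  define A B T where "A = f wa" and "B = f wb" and "T = f wt"
  have single: "f [(g, True)] = letter A B T (g, True)" for g
    by (cases g) (simp_all add: A_def B_def T_def wa_def wb_def wt_def)
  have letter: "f [p] = letter A B T p" for p
  proof (cases p)
    case (Pair g b)
    show ?thesis
    proof (cases b)
      case False
      have "f [(g, True)] * f [(g, False)] = 1"
        using f_cong[OF word_eq.cancel[of relN g True]] f_append[of "[(g, True)]" "[(g, False)]"]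
        by (simp add: f_Nil)
      then have "adj2 (f [(g, True)]) * (f [(g, True)] * f [(g, False)]) = adj2 (f [(g, True)])"
        by simp
      then have "f [(g, False)] = adj2 (f [(g, True)])"
        using sl2_inverse(4)[OF f_det, of "[(g, True)]" "f [(g, False)]"] by simp
      then show ?thesis
        using False by (simp only: Pair single adj2_letter) simp
    qed (simp add: Pair single)
  qed
  have f_eq: "f w = weval A B T w" for w
  proof (induction w)
    case (Cons p w)
    then show ?case using f_append[of "[p]" w] by (simp add: letter)
  qed (simp add: f_Nil)
  have "weval A B T u = weval A B T v" if "(u, v) \<in> relN" for u v
    using f_cong[OF word_eq.rel[OF that]] by (simp only: f_eq)
  moreover have "det2 A = 1" "det2 B = 1" "det2 T = 1"
    by (simp_all only: A_def B_def T_def f_det)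
  ultimately have "is_rep A B T"
    by (auto simp: is_rep_def)
  then show thesis
    using that f_eq by (simp add: f_def)
qed

lemma XN_E:
  assumes "\<psi> \<in> XN"
  obtains A B T where "is_rep A B T" "\<And>w. \<psi> (word_class relN w) = tr2 (weval A B T w)"
proof -
  obtain \<rho> where \<rho>: "\<rho> \<in> hom piN SL2C" "\<psi> = character \<rho>"
    using assms by (auto simp: XN_def)
  obtain A B T where AB: "is_rep A B T" "\<And>w. of_mat (\<rho> (word_class relN w)) = weval A B T w"
    using hom_weval[OF \<rho>(1)] by metis
  show thesis
  proof (rule that[OF AB(1)])
    show "\<psi> (word_class relN w) = tr2 (weval A B T w)" for w
      by (simp add: \<rho>(2) character_def piN_def presented_group_def of_mat_simps AB(2))
  qed
qed

lemma XN_I: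
  assumes rep: "is_rep A B T"
  obtains \<psi> where "\<psi> \<in> XN" "\<And>w. \<psi> (word_class relN w) = tr2 (weval A B T w)"
proof -
  \<comment> \<open>A class is evaluated on an arbitrary representative; by
    \<open>weval_cong\<close> the choice does not matter.\<close>
  define \<rho> where "\<rho> C = to_mat (weval A B T (SOME w. C = word_class relN w))" for C
  have \<rho>: "\<rho> (word_class relN w) = to_mat (weval A B T w)" for w
  proof -
    have "word_class relN w = word_class relN (SOME v. word_class relN w = word_class relN v)"
      by (rule someI) simp
    then show ?thesis
      unfolding \<rho>_def using weval_cong[OF rep] by (simp add: word_class_eq_iff)
  qed
  have "\<rho> \<in> hom piN SL2C"
  proof (rule homI)
    fix C assume "C \<in> carrier piN"
    then show "\<rho> C \<in> carrier SL2C"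
      by (auto simp: piN_def presented_group_def \<rho> SL2C_def of_mat_simps det2_weval[OF rep])
  next
    fix C D assume "C \<in> carrier piN" "D \<in> carrier piN"
    then obtain u v where "C = word_class relN u" "D = word_class relN v"
      by (auto simp: piN_def presented_group_def)
    then show "\<rho> (C \<otimes>\<^bsub>piN\<^esub> D) = \<rho> C \<otimes>\<^bsub>SL2C\<^esub> \<rho> D"
      by (simp add: piN_def presented_group_mult \<rho> SL2C_def of_mat_eq_iff[symmetric] of_mat_simps)
  qed
  then have "character \<rho> \<in> XN" by (simp add: XN_def)
  then show thesis
    by (rule that) (simp add: character_def piN_def presented_group_def of_mat_simps
        piN_def[symmetric] \<rho>)
qed

lemma discrete_faithful_E:
  assumes "discrete_faithful \<rho>"
  obtains A B T where "is_rep A B T" "\<And>w. character \<rho> (word_class relN w) = tr2 (weval A B T w)"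
    "\<And>u v. weval A B T u = weval A B T v \<Longrightarrow> word_eq relN u v"
proof -
  have \<rho>: "\<rho> \<in> hom piN SL2C" "inj_on \<rho> (carrier piN)"
    using assms by (auto simp: discrete_faithful_def)
  obtain A B T where AB: "is_rep A B T" "\<And>w. of_mat (\<rho> (word_class relN w)) = weval A B T w"
    using hom_weval[OF \<rho>(1)] by metis
  have cls: "word_class relN w \<in> carrier piN" for w
    by (simp add: piN_def presented_group_def)
  show thesis
  proof (rule that[OF AB(1)])
    show "character \<rho> (word_class relN w) = tr2 (weval A B T w)" for w
      by (simp add: character_def cls of_mat_simps AB(2))
    show "word_eq relN u v" if "weval A B T u = weval A B T v" for u v
      using that inj_onD[OF \<rho>(2) _ cls cls, of u v]
      by (simp add: AB(2)[symmetric] of_mat_eq_iff word_class_eq_iff)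
  qed
qed

section \<open>Trace relations\<close>

text \<open>Together with \<open>1\<close>, \<open>B\<close> and \<open>A * B\<close>, the matrices
  whose traces are prescribed here are the eight generators of \<open>spanned\<close>; hence
  \<open>y\<close> and \<open>z\<close> determine the trace of every word.\<close>

definition on_curve :: "complex \<Rightarrow> mat2 \<Rightarrow> mat2 \<Rightarrow> mat2 \<Rightarrow> bool" where
  "on_curve \<omega> A B T \<longleftrightarrow> is_rep A B T \<and>
     (let y = tr2 B; z = tr2 (A * B) in
       z\<^sup>2 * (y\<^sup>2 - 2) = 8 \<and> tr2 A = y * z / 2 \<and> tr2 T = \<omega> * z\<^sup>2 / 2 \<and> tr2 (A * T) = \<omega> * z * y / 2 \<and>
       tr2 (B * T) = \<omega> * (z\<^sup>2 * y / 2 - y) \<and> tr2 (A * B * T) = \<omega> * z)"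

lemma is_rep_iff:
  "is_rep A B T \<longleftrightarrow> det2 A = 1 \<and> det2 B = 1 \<and> det2 T = 1 \<and>
     T * A * adj2 T = adj2 (B * A * B) \<and>
     T * B * adj2 T = B * A * adj2 (B * A * B) * adj2 (B * A * B) * adj2 (B * A * B)"
  by (simp add: is_rep_def relN_def Let_def weval_winv adj2_mult mult.assoc)

text \<open>The third form of the relations is free of inverses: \<open>B * ?A * B * A = 1\<close>
  cancels what stands before the cube of \<open>?A\<close>, and the first relation turns
  \<open>?A * ?A * ?A * T\<close> into \<open>T * A * A * A\<close>.\<close>

lemma is_rep_relations:
  assumes "is_rep A B T"
  shows "T * A = adj2 (B * A * B) * T"
    and "T * B = B * A * adj2 (B * A * B) * adj2 (B * A * B) * adj2 (B * A * B) * T"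
    and "B * T * A * B = T * A * A * A"
proof -
  let ?A = "adj2 (B * A * B)"
  have d: "det2 A = 1" "det2 B = 1" "det2 T = 1" and A: "T * A * adj2 T = ?A"
    and B: "T * B * adj2 T = B * A * ?A * ?A * ?A"
    using assms by (auto simp: is_rep_iff)
  have "T * M * adj2 T * T = T * M" for M
    by (simp add: mult.assoc sl2_inverse d)
  then show TA: "T * A = ?A * T" and TB: "T * B = B * A * ?A * ?A * ?A * T"
    using A B by metis+
  have "B * T * A * B = B * ?A * (T * B)"
    using TA by (simp add: mult.assoc)
  also have "\<dots> = B * ?A * B * A * ?A * ?A * ?A * T"
    by (simp only: TB mult.assoc)
  also have "B * ?A * B * A = 1"
    by (simp add: adj2_mult mult.assoc sl2_inverse d)
  finally have "B * T * A * B = ?A * ?A * (?A * T)"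
    by (simp add: mult.assoc)
  also have "\<dots> = T * A * A * A"
    by (metis TA mult.assoc)
  finally show "B * T * A * B = T * A * A * A" .
qed

lemma sl2_BAB:
  assumes "det2 A = 1" "det2 B = 1"
  shows "B * A * B = scale2 (tr2 (A * B)) B - adj2 A"
proof -
  \<comment> \<open>\<open>B * A * B\<close> is the inverse of \<open>A\<close> times the square of
    \<open>A * B\<close>, to which Cayley-Hamilton applies.\<close>
  have "adj2 A * ((A * B) * (A * B)) = adj2 A * (scale2 (tr2 (A * B)) (A * B) - 1)"
    using sl2_square[of "A * B"] assms by (simp add: det2_mult)
  then show ?thesis
    using assms by (simp add: mult.assoc sl2_inverse right_diff_distrib)
qed

lemma sl2_cube:
  assumes "det2 A = 1"
  shows "A * A * A = scale2 ((tr2 A)\<^sup>2 - 1) A - scale2 (tr2 A) 1"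
  by (simp add: sl2_square[OF assms] left_diff_distrib scale2_distrib power2_eq_square)

text \<open>Conjugation by \<open>T\<close> preserves traces, so the images of \<open>A\<close> and
  \<open>B\<close> under the monodromy have the traces \<open>x\<close> and
  \<open>y\<close>.\<close>

lemma rep_fibre_equations:
  assumes rep: "is_rep A B T"
  defines "x \<equiv> tr2 A" and "y \<equiv> tr2 B" and "z \<equiv> tr2 (A * B)"
  shows "2 * x = y * z" and "2 * y = x\<^sup>2 * y - x * z"
proof -
  let ?A = "adj2 (B * A * B)"
  have d: "det2 A = 1" "det2 B = 1" "det2 T = 1" "det2 ?A = 1"
    using rep by (auto simp: is_rep_def det2_mult)
  have conj: "tr2 (T * M * adj2 T) = tr2 M" for M
    using tr2_mult_commute[of "T * M" "adj2 T"] by (simp add: sl2_inverse d)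
  have tA: "tr2 ?A = x"
    using conj[of A] rep by (simp add: is_rep_iff x_def)
  have "tr2 (B * A * B) = z * y - x"
    by (simp add: sl2_BAB d tr2_simps x_def y_def z_def)
  with tA show "2 * x = y * z"
    by (simp add: algebra_simps)
  \<comment> \<open>As \<open>?A\<close> has trace \<open>x\<close>, Cayley-Hamilton reduces its
    cube to \<open>?A\<close> and \<open>1\<close>; and \<open>B * A * ?A\<close> has trace
    \<open>y\<close>, being conjugate to the inverse of \<open>B\<close>.\<close>
  have "?A * ?A * ?A = scale2 (x\<^sup>2 - 1) ?A - scale2 x 1"
    using sl2_cube[OF d(4)] tA by simp
  then have "tr2 (B * A * (?A * ?A * ?A)) = (x\<^sup>2 - 1) * tr2 (B * A * ?A) - x * tr2 (B * A)"
    by (simp add: right_diff_distrib tr2_simps)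
  moreover have "tr2 (B * A * (?A * ?A * ?A)) = y"
    using conj[of B] rep by (simp add: is_rep_iff y_def mult.assoc)
  moreover have "tr2 (B * A * ?A) = y"
    using tr2_mult_commute[of B "A * ?A"] tr2_mult_commute[of A "adj2 B * adj2 A"]
    by (simp add: adj2_mult mult.assoc sl2_inverse d y_def)
  ultimately show "2 * y = x\<^sup>2 * y - x * z"
    by (simp add: z_def tr2_mult_commute[of B A] algebra_simps)
qed

text \<open>The four relations are, in this order, the traces of
  \<open>T * A = adj2 (B * A * B) * T\<close>, of the same equation multiplied by \<open>A\<close>,
  of \<open>B * T * A * B = T * A * A * A\<close>, and of the commutator of \<open>T\<close> and
  \<open>A\<close>.\<close>

lemma rep_trace_relations:
  assumes rep: "is_rep A B T"
  defines "x \<equiv> tr2 A" and "y \<equiv> tr2 B" and "z \<equiv> tr2 (A * B)" and "t \<equiv> tr2 T"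
    and "a \<equiv> tr2 (A * T)" and "b \<equiv> tr2 (B * T)" and "c \<equiv> tr2 (A * B * T)"
  shows "2 * a = 2 * x * t - z * b" and "2 * t = z * c" and "y * c = x\<^sup>2 * a - x * t"
    and "t\<^sup>2 + x\<^sup>2 + a\<^sup>2 - t * x * a = z\<^sup>2"
proof -
  let ?A = "adj2 (B * A * B)"
  have d: "det2 A = 1" "det2 B = 1" "det2 T = 1" "det2 ?A = 1"
    using rep by (auto simp: is_rep_def det2_mult)
  have swap: "T * A = ?A * T" "B * T * A * B = T * A * A * A"
    using is_rep_relations[OF rep] by simp_all
  have "tr2 (B * A * B) = z * y - x"
    by (simp add: sl2_BAB d tr2_simps x_def y_def z_def)
  then have "tr2 (B * A * B) = x"
    using rep_fibre_equations(1)[OF rep] by (simp add: x_def y_def z_def mult.commute)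
  moreover have dbl: "scale2 (2 * x) M = scale2 x M + scale2 x M" for M
    by (simp add: scale2_distrib(3)[symmetric])
  ultimately have "?A = scale2 x 1 - B * A * B"
    by (simp only: adj2_eq)
  \<comment> \<open>Since \<open>B * A * B\<close> also has trace \<open>x\<close>, its adjugate is
    a linear combination of \<open>1\<close>, \<open>A\<close> and \<open>B\<close>; this makes the
    next two trace equations linear in \<open>t, a, b, c\<close>.\<close>
  then have A': "?A = scale2 (2 * x) 1 - scale2 z B - A"
    by (simp only: sl2_BAB[OF d(1,2)] adj2_eq[of A])
      (simp only: dbl, simp add: x_def z_def)
  have "tr2 (T * A) = tr2 ((scale2 (2 * x) 1 - scale2 z B - A) * T)"
    by (simp only: swap(1) A')
  also have "\<dots> = 2 * x * t - z * b - a"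
    by (simp add: left_diff_distrib tr2_simps mult.assoc a_def b_def t_def)
  finally show "2 * a = 2 * x * t - z * b"
    by (simp add: tr2_mult_commute[of T A] a_def)
  have AA: "A * (A * M) = scale2 x (A * M) - M" for M
    using sl2_square[OF d(1)] by (simp add: mult.assoc[symmetric] left_diff_distrib x_def)
  have "tr2 (A * (T * A)) = tr2 (A * ((scale2 (2 * x) 1 - scale2 z B - A) * T))"
    by (simp only: swap(1) A')
  also have "\<dots> = 2 * x * a - z * c - (x * a - t)"
    by (simp add: left_diff_distrib right_diff_distrib tr2_simps mult.assoc AA
        a_def c_def t_def)
  also have "tr2 (A * (T * A)) = x * a - t"
    using tr2_mult_commute[of "A * T" A]
    by (simp add: mult.assoc AA tr2_simps a_def t_def)
  finally show "2 * t = z * c"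
    by (simp add: algebra_simps)
  have BB: "B * (B * M) = scale2 y (B * M) - M" for M
    using sl2_square[OF d(2)] by (simp add: mult.assoc[symmetric] left_diff_distrib y_def)
  have "tr2 (B * T * A * B) = tr2 (A * (B * (B * T)))"
    using tr2_mult_commute[of "B * T" "A * B"] by (simp add: mult.assoc)
  also have "\<dots> = y * c - a"
    by (simp only: BB) (simp add: right_diff_distrib tr2_simps a_def c_def mult.assoc)
  also have "tr2 (B * T * A * B) = tr2 (A * (A * (A * T)))"
    using tr2_mult_commute[of T "A * (A * A)"] by (simp only: swap(2)) (simp only: mult.assoc)
  also have "\<dots> = x * (x * a - t) - a"
    by (simp add: AA right_diff_distrib tr2_simps a_def t_def)
  finally show "y * c = x\<^sup>2 * a - x * t"
    by (simp add: algebra_simps power2_eq_square)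
  have "tr2 (T * A * adj2 T * adj2 A) = tr2 (?A * adj2 A)"
    using rep by (simp add: is_rep_iff)
  \<comment> \<open>\<open>?A * adj2 A\<close> is the adjugate of
    \<open>A * B * A * B\<close>.\<close>
  also have "\<dots> = tr2 ((A * B) * (A * B))"
    by (metis adj2_mult tr2_adj2 mult.assoc)
  also have "\<dots> = z * z - 2"
    using sl2_square[of "A * B"] by (simp add: det2_mult d tr2_simps z_def)
  finally have "tr2 (T * A * adj2 T * adj2 A) = z * z - 2" .
  then have "t\<^sup>2 + x\<^sup>2 + a\<^sup>2 - t * x * a - 2 = z * z - 2"
    unfolding tr2_commutator[OF d(3) d(1)]
    by (simp only: tr2_mult_commute[of T A] t_def x_def a_def)
  then show "t\<^sup>2 + x\<^sup>2 + a\<^sup>2 - t * x * a = z\<^sup>2"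
    by (simp add: power2_eq_square add.assoc add_diff_eq)
qed

lemma rep_dichotomy:
  assumes rep: "is_rep A B T"
  shows "tr2 B = 0 \<or> (tr2 (A * B))\<^sup>2 * ((tr2 B)\<^sup>2 - 2) = 8"
proof -
  define y z where "y = tr2 B" and "z = tr2 (A * B)"
  have x: "tr2 A = y * z / 2"
    using rep_fibre_equations(1)[OF rep] by (simp add: y_def z_def mult.commute)
  have "2 * y = (y * z / 2)\<^sup>2 * y - (y * z / 2) * z"
    using rep_fibre_equations(2)[OF rep] unfolding x by (simp add: y_def z_def)
  then have "y * (z\<^sup>2 * (y\<^sup>2 - 2) - 8) = 0"
    by (simp add: field_simps power2_eq_square)
  then show ?thesis by (simp add: y_def z_def)
qed

text \<open>The linear relations give the traces of \<open>A * T\<close>, \<open>B * T\<close> and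
  \<open>A * B * T\<close> as multiples of \<open>t\<close>; the commutator relation then becomes an
  equation for \<open>t^2\<close>. Powers of \<open>z\<close> are multiplied out instead of divided
  by.\<close>

lemma rep_tau_traces:
  assumes rep: "is_rep A B T" and y0: "tr2 B \<noteq> 0" and z4: "(tr2 (A * B))\<^sup>2 \<noteq> 4"
  defines "y \<equiv> tr2 B" and "z \<equiv> tr2 (A * B)" and "t \<equiv> tr2 T"
  shows "z * tr2 (A * T) = t * y" and "z\<^sup>2 * tr2 (B * T) = t * y * (z\<^sup>2 - 2)"
    and "z * tr2 (A * B * T) = 2 * t" and "t\<^sup>2 = - (z ^ 4 / 4)"
proof -
  define a b c where "a = tr2 (A * T)" and "b = tr2 (B * T)" and "c = tr2 (A * B * T)"
  have x: "tr2 A = y * z / 2"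
    using rep_fibre_equations(1)[OF rep] by (simp add: y_def z_def mult.commute)
  have V: "z\<^sup>2 * (y\<^sup>2 - 2) = 8"
    using rep_dichotomy[OF rep] y0 by (simp add: y_def z_def)
  then have z0: "z \<noteq> 0" by auto
  note rels = rep_trace_relations[OF rep, unfolded x, folded y_def z_def t_def a_def b_def c_def]
  show zc: "z * tr2 (A * B * T) = 2 * t"
    using rels(2) by (simp add: c_def)
  have rels3: "4 * (y * c) = y * y * z * z * a - 2 * y * z * t"
    using rels(3) by (simp add: field_simps power2_eq_square)
  have "y * (y * z * z * (z * a)) = y * (4 * z * c + 2 * z * z * t)"
    using arg_cong[OF rels3, of "\<lambda>u. z * u"] by (simp add: algebra_simps)
  then have "y * z * z * (z * a) = 8 * t + 2 * z * z * t"
    using y0 zc by (simp add: y_def c_def)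
  \<comment> \<open>The curve equation times \<open>t\<close> has the same right-hand side, so
    \<open>z * a\<close> and \<open>t * y\<close> agree after cancelling
    \<open>y * z^2\<close>.\<close>
  moreover have "y * z * z * (t * y) = 8 * t + 2 * z * z * t"
    using arg_cong[OF V, of "\<lambda>u. u * t"] by (simp add: algebra_simps power2_eq_square)
  ultimately have "y * z * z * (z * a - t * y) = 0"
    by (simp add: algebra_simps)
  then show za: "z * tr2 (A * T) = t * y"
    using y0 z0 by (simp add: y_def a_def)
  have zb: "z * b = y * z * t - 2 * a"
    using rels(1) by (simp add: algebra_simps)
  have "z * (z * b) = z * (y * z * t - 2 * a)"
    by (simp only: zb)
  also have "\<dots> = t * y * (z * z - 2)"
    using za by (simp add: algebra_simps a_def)
  finally show "z\<^sup>2 * tr2 (B * T) = t * y * (z\<^sup>2 - 2)"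
    by (simp add: b_def power2_eq_square mult.assoc)
  have "z\<^sup>2 * z\<^sup>2 = z\<^sup>2 * t\<^sup>2 + z\<^sup>2 * (y * z / 2)\<^sup>2 + (z * a)\<^sup>2 - t * (y * z / 2) * z * (z * a)"
    using arg_cong[OF rels(4), of "\<lambda>u. z\<^sup>2 * u"] by (simp add: algebra_simps power2_eq_square)
  then have "z\<^sup>2 * z\<^sup>2 = z\<^sup>2 * t\<^sup>2 + z\<^sup>2 * (y * z / 2)\<^sup>2 + (t * y)\<^sup>2 - t * (y * z / 2) * z * (t * y)"
    by (simp only: za[folded a_def])
  from arg_cong[OF this, of "\<lambda>u. 4 * (z\<^sup>2 * u)"]
  have "4 * (z\<^sup>2 * (z\<^sup>2 * z\<^sup>2)) = 4 * z ^ 4 * t\<^sup>2 + z ^ 4 * (z\<^sup>2 * y\<^sup>2) + 4 * t\<^sup>2 * (z\<^sup>2 * y\<^sup>2)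
      - 2 * t\<^sup>2 * z\<^sup>2 * (z\<^sup>2 * y\<^sup>2)"
    by (simp add: algebra_simps power2_eq_square power4_eq_xxxx)
  also have "z\<^sup>2 * y\<^sup>2 = 8 + 2 * z\<^sup>2"
    using V by (simp add: algebra_simps)
  \<comment> \<open>Eliminating \<open>y\<close> by the curve equation produces the factor
    \<open>z^2 - 4\<close>; where it vanishes this equation does not constrain
    \<open>t\<close>.\<close>
  finally have "(z\<^sup>2 - 4) * (8 * t\<^sup>2 + 2 * z ^ 4) = 0"
    by (simp add: field_simps power2_eq_square power4_eq_xxxx)
  moreover have "z\<^sup>2 - 4 \<noteq> 0"
    using z4 by (simp add: z_def)
  ultimately have "8 * t\<^sup>2 + 2 * z ^ 4 = 0"
    by (metis mult_eq_0_iff)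
  then have "2 * (z ^ 4 + 4 * t\<^sup>2) = 0"
    by (simp add: algebra_simps)
  then have "z ^ 4 + 4 * t\<^sup>2 = 0"
    by (metis mult_eq_0_iff zero_neq_numeral)
  then show "t\<^sup>2 = - (z ^ 4 / 4)"
    by (simp add: field_simps eq_neg_iff_add_eq_0)
qed


lemma on_curveI:
  assumes rep: "is_rep A B T" and y0: "tr2 B \<noteq> 0" and z4: "(tr2 (A * B))\<^sup>2 \<noteq> 4"
    and t: "tr2 T = \<omega> * (tr2 (A * B))\<^sup>2 / 2"
  shows "on_curve \<omega> A B T"
proof -
  define y z where "y = tr2 B" and "z = tr2 (A * B)"
  have V: "z\<^sup>2 * (y\<^sup>2 - 2) = 8"
    using rep_dichotomy[OF rep] y0 by (simp add: y_def z_def)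
  then have z0: "z \<noteq> 0" by auto
  note tau = rep_tau_traces[OF rep y0 z4, unfolded t, folded y_def z_def]
  have "z * tr2 (A * T) = z * (\<omega> * z * y / 2)"
    using tau(1) by (simp add: power2_eq_square algebra_simps)
  then have a: "tr2 (A * T) = \<omega> * z * y / 2" using z0 by (metis mult_cancel_left)
  have "z\<^sup>2 * tr2 (B * T) = z\<^sup>2 * (\<omega> * (z\<^sup>2 * y / 2 - y))"
    using tau(2) by (simp add: power2_eq_square algebra_simps)
  then have b: "tr2 (B * T) = \<omega> * (z\<^sup>2 * y / 2 - y)"
    using z0 by (metis mult_cancel_left power_eq_0_iff)
  have "z * tr2 (A * B * T) = z * (\<omega> * z)"
    using tau(3) by (simp add: power2_eq_square algebra_simps)
  then have c: "tr2 (A * B * T) = \<omega> * z" using z0 by (metis mult_cancel_left)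
  have x: "tr2 A = y * z / 2"
    using rep_fibre_equations(1)[OF rep] by (simp add: y_def z_def mult.commute)
  show ?thesis
    unfolding on_curve_def Let_def
    using rep V x t a b c by (simp add: y_def z_def)
qed

section \<open>Traces of words as polynomials in \<open>z\<close> and \<open>y\<close>\<close>

text \<open>Polynomials are kept as functions, since they are compared only by their values on the
  curve. Constants from \<open>insert \<omega> \<rat>\<close> generate the coefficient ring, which
  is the field \<rat>(\<omega>) when \<open>\<omega> * \<omega> = -1\<close>.\<close>

inductive polyfun :: "complex set \<Rightarrow> (complex \<Rightarrow> complex \<Rightarrow> complex) \<Rightarrow> bool" for K where
  const: "c \<in> K \<Longrightarrow> polyfun K (\<lambda>z y. c)"
| fst: "polyfun K (\<lambda>z y. z)"
| snd: "polyfun K (\<lambda>z y. y)"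
| add: "polyfun K f \<Longrightarrow> polyfun K g \<Longrightarrow> polyfun K (\<lambda>z y. f z y + g z y)"
| mult: "polyfun K f \<Longrightarrow> polyfun K g \<Longrightarrow> polyfun K (\<lambda>z y. f z y * g z y)"

lemma polyfun_mono:
  assumes "polyfun K f" "K \<subseteq> K'"
  shows "polyfun K' f"
  using assms(1) by induction (use assms(2) in \<open>auto intro: polyfun.intros\<close>)

lemma polyfun_uminus:
  assumes "polyfun K f" "-1 \<in> K"
  shows "polyfun K (\<lambda>z y. - f z y)"
  using polyfun.mult[OF polyfun.const[OF assms(2)] assms(1)] by simp

lemma polyfun_diff:
  assumes "polyfun K f" "polyfun K g" "-1 \<in> K"
  shows "polyfun K (\<lambda>z y. f z y - g z y)"
  using polyfun.add[OF assms(1) polyfun_uminus[OF assms(2,3)]] by simp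

lemma polyfun_power:
  assumes "polyfun K f" "1 \<in> K"
  shows "polyfun K (\<lambda>z y. f z y ^ n)"
proof (induction n)
  case 0 show ?case using polyfun.const[OF assms(2)] by simp
next
  case (Suc n) show ?case using polyfun.mult[OF assms(1) Suc] by simp
qed

text \<open>The coefficients are functions of \<open>z = tr (\<alpha>\<beta>)\<close> and \<open>y = tr \<beta>\<close> alone, so that the trace
  of a spanned family is one polynomial for all representations on the curve.\<close>

inductive spanned :: "complex \<Rightarrow> (mat2 \<Rightarrow> mat2 \<Rightarrow> mat2 \<Rightarrow> mat2) \<Rightarrow> bool" for \<omega> where
  gen1: "spanned \<omega> (\<lambda>A B T. 1)"
| genA: "spanned \<omega> (\<lambda>A B T. A)"
| genB: "spanned \<omega> (\<lambda>A B T. B)"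
| genAB: "spanned \<omega> (\<lambda>A B T. A * B)"
| genT: "spanned \<omega> (\<lambda>A B T. T)"
| genAT: "spanned \<omega> (\<lambda>A B T. A * T)"
| genBT: "spanned \<omega> (\<lambda>A B T. B * T)"
| genABT: "spanned \<omega> (\<lambda>A B T. A * B * T)"
| add: "spanned \<omega> F \<Longrightarrow> spanned \<omega> G \<Longrightarrow> spanned \<omega> (\<lambda>A B T. F A B T + G A B T)"
| scale: "polyfun (insert \<omega> \<rat>) f \<Longrightarrow> spanned \<omega> F \<Longrightarrow>
    spanned \<omega> (\<lambda>A B T. scale2 (f (tr2 (A * B)) (tr2 B)) (F A B T))"
| cong: "spanned \<omega> F \<Longrightarrow> (\<And>A B T. on_curve \<omega> A B T \<Longrightarrow> G A B T = F A B T) \<Longrightarrow> spanned \<omega> G"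

lemma spanned_trace:
  assumes "spanned \<omega> F"
  shows "\<exists>f. polyfun (insert \<omega> \<rat>) f \<and>
    (\<forall>A B T. on_curve \<omega> A B T \<longrightarrow> tr2 (F A B T) = f (tr2 (A * B)) (tr2 B))"
  using assms
proof induction
  let ?K = "insert \<omega> \<rat>"
  have half: "polyfun ?K (\<lambda>z y. f z y / 2)" if "polyfun ?K f" for f
    using polyfun.mult[OF polyfun.const[of "1/2"] that] by simp
  have \<omega>: "polyfun ?K (\<lambda>z y. \<omega>)" by (rule polyfun.const) simp
  note intros = polyfun.fst polyfun.snd polyfun.mult half \<omega> polyfun_diff polyfun_power
  have minus1: "- 1 \<in> ?K" and plus1: "1 \<in> ?K" by auto
  {
    case gen1
    show ?case by (rule exI[of _ "\<lambda>z y. 2"]) (auto simp: tr2_simps intro: polyfun.const)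
  next
    case genA
    show ?case by (rule exI[of _ "\<lambda>z y. y * z / 2"]) (auto simp: on_curve_def Let_def intro!: intros)
  next
    case genB
    show ?case by (rule exI[of _ "\<lambda>z y. y"]) (auto intro!: intros)
  next
    case genAB
    show ?case by (rule exI[of _ "\<lambda>z y. z"]) (auto intro!: intros)
  next
    case genT
    show ?case by (rule exI[of _ "\<lambda>z y. \<omega> * z\<^sup>2 / 2"])
        (auto simp: on_curve_def Let_def intro!: intros)
  next
    case genAT
    show ?case by (rule exI[of _ "\<lambda>z y. \<omega> * z * y / 2"])
        (auto simp: on_curve_def Let_def intro!: intros)
  next
    case genBT
    show ?case by (rule exI[of _ "\<lambda>z y. \<omega> * (z\<^sup>2 * y / 2 - y)"])
        (auto simp: on_curve_def Let_def intro!: intros)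
  next
    case genABT
    show ?case by (rule exI[of _ "\<lambda>z y. \<omega> * z"])
        (auto simp: on_curve_def Let_def intro!: intros)
  next
    case (add F G)
    then obtain f g where "polyfun ?K f" "polyfun ?K g"
      "\<forall>A B T. on_curve \<omega> A B T \<longrightarrow> tr2 (F A B T) = f (tr2 (A * B)) (tr2 B)"
      "\<forall>A B T. on_curve \<omega> A B T \<longrightarrow> tr2 (G A B T) = g (tr2 (A * B)) (tr2 B)" by blast
    then show ?case
      by (intro exI[of _ "\<lambda>z y. f z y + g z y"]) (auto simp: tr2_simps intro: polyfun.add)
  next
    case (scale h F)
    then obtain f where "polyfun ?K f"
      "\<forall>A B T. on_curve \<omega> A B T \<longrightarrow> tr2 (F A B T) = f (tr2 (A * B)) (tr2 B)" by blast
    with scale.hyps show ?case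
      by (intro exI[of _ "\<lambda>z y. h z y * f z y"]) (auto simp: tr2_simps intro: polyfun.mult)
  next
    case (cong F G)
    then show ?case by metis
  }
qed

lemma spanned_scale:
  assumes "spanned \<omega> F" "polyfun (insert \<omega> \<rat>) f"
    and "\<And>A B T. on_curve \<omega> A B T \<Longrightarrow> c A B T = f (tr2 (A * B)) (tr2 B)"
  shows "spanned \<omega> (\<lambda>A B T. scale2 (c A B T) (F A B T))"
  by (rule spanned.cong[OF spanned.scale[OF assms(2,1)]]) (simp add: assms(3))

lemma spanned_diff:
  assumes "spanned \<omega> F" "spanned \<omega> G"
  shows "spanned \<omega> (\<lambda>A B T. F A B T - G A B T)"
proof -
  have "spanned \<omega> (\<lambda>A B T. scale2 (-1) (G A B T))"
    by (rule spanned_scale[OF assms(2), of "\<lambda>z y. -1"]) (auto intro: polyfun.const)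
  from spanned.add[OF assms(1) this] show ?thesis
    by (rule spanned.cong) (simp add: scale2_def mat2_defs)
qed

lemma spanned_scale_traces:
  assumes "spanned \<omega> F"
  shows "spanned \<omega> (\<lambda>A B T. scale2 (tr2 A) (F A B T))"
    and "spanned \<omega> (\<lambda>A B T. scale2 (tr2 B) (F A B T))"
    and "spanned \<omega> (\<lambda>A B T. scale2 (tr2 (A * B)) (F A B T))"
    and "spanned \<omega> (\<lambda>A B T. scale2 (tr2 T) (F A B T))"
proof -
  let ?K = "insert \<omega> \<rat>"
  have half: "polyfun ?K (\<lambda>z y. f z y / 2)" if "polyfun ?K f" for f
    using polyfun.mult[OF polyfun.const[of "1/2"] that] by simp
  have \<omega>: "polyfun ?K (\<lambda>z y. \<omega>)" by (rule polyfun.const) simp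
  have one: "1 \<in> ?K" by auto
  note intros = polyfun.fst polyfun.snd polyfun.mult half \<omega> polyfun_power[OF _ one]
  show "spanned \<omega> (\<lambda>A B T. scale2 (tr2 A) (F A B T))"
    by (rule spanned_scale[OF assms, of "\<lambda>z y. y * z / 2"])
      (auto simp: on_curve_def Let_def intro!: intros)
  show "spanned \<omega> (\<lambda>A B T. scale2 (tr2 B) (F A B T))"
    by (rule spanned_scale[OF assms, of "\<lambda>z y. y"]) (auto intro!: intros)
  show "spanned \<omega> (\<lambda>A B T. scale2 (tr2 (A * B)) (F A B T))"
    by (rule spanned_scale[OF assms, of "\<lambda>z y. z"]) (auto intro!: intros)
  show "spanned \<omega> (\<lambda>A B T. scale2 (tr2 T) (F A B T))"
    by (rule spanned_scale[OF assms, of "\<lambda>z y. \<omega> * z\<^sup>2 / 2"])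
      (auto simp: on_curve_def Let_def intro!: intros)
qed

lemma on_curve_det: "on_curve \<omega> A B T \<Longrightarrow> det2 A = 1 \<and> det2 B = 1 \<and> det2 T = 1"
  by (simp add: on_curve_def is_rep_def)

lemma sl2_square_left: "det2 A = 1 \<Longrightarrow> A * (A * M) = scale2 (tr2 A) (A * M) - M"
  by (simp add: mult.assoc[symmetric] sl2_square left_diff_distrib)

text \<open>Cayley-Hamilton polarised; it reorders \<open>B * A\<close>, so that
  \<open>1, A, B, A * B\<close> suffice for words in \<open>A\<close> and \<open>B\<close>.\<close>

lemma anticommutator:
  "B * A = scale2 (tr2 (A * B)) 1 - scale2 (tr2 A * tr2 B) 1 + scale2 (tr2 B) A
    + scale2 (tr2 A) B - A * B"
  by (simp add: scale2_def tr2_def mat2_defs algebra_simps)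

text \<open>A word is built by multiplying on the left, so it is enough that the span absorbs each
  letter from the left. For \<open>A\<close> a generator becomes another one or is reduced by
  Cayley-Hamilton.\<close>

lemma spanned_A:
  assumes "spanned \<omega> F"
  shows "spanned \<omega> (\<lambda>A B T. A * F A B T)"
  using assms
proof induction
  have *: "spanned \<omega> (\<lambda>A B T. A * (A * F A B T))"
    if F: "spanned \<omega> F" and AF: "spanned \<omega> (\<lambda>A B T. A * F A B T)" for F
    by (rule spanned.cong[OF spanned_diff[OF spanned_scale_traces(1)[OF AF] F]])
      (simp add: sl2_square_left on_curve_det)
  {
    case gen1 show ?case using spanned.genA by simp
  next
    case genA show ?case using *[OF spanned.gen1] spanned.genA by simp
  next
    case genB show ?case by (rule spanned.genAB)
  next
    case genAB show ?case using *[OF spanned.genB spanned.genAB] by simp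
  next
    case genT show ?case by (rule spanned.genAT)
  next
    case genAT show ?case by (rule *[OF spanned.genT spanned.genAT])
  next
    case genBT show ?case using spanned.genABT by (simp add: mult.assoc)
  next
    case genABT
    show ?case using *[OF spanned.genBT] spanned.genABT by (simp add: mult.assoc)
  next
    case (add F G) then show ?case using spanned.add by (simp add: distrib_left)
  next
    case (scale f F) then show ?case using spanned.scale by simp
  next
    case (cong F G) show ?case by (rule spanned.cong[OF cong.IH]) (simp add: cong.hyps)
  }
qed

lemma spanned_B:
  assumes "spanned \<omega> F"
  shows "spanned \<omega> (\<lambda>A B T. B * F A B T)"
  using assms
proof induction
  note closed = spanned.add spanned_diff spanned_scale_traces spanned_A
  have BB: "spanned \<omega> (\<lambda>A B T. B * (B * F A B T))"
    if F: "spanned \<omega> F" and BF: "spanned \<omega> (\<lambda>A B T. B * F A B T)" for F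
    by (rule spanned.cong[OF spanned_diff[OF spanned_scale_traces(2)[OF BF] F]])
      (simp add: sl2_square_left on_curve_det)
  \<comment> \<open>The anticommutator puts \<open>A\<close> in front of \<open>B\<close>, where
    \<open>spanned_A\<close> absorbs it.\<close>
  have BA: "spanned \<omega> (\<lambda>A B T. B * (A * F A B T))"
    if F: "spanned \<omega> F" and BF: "spanned \<omega> (\<lambda>A B T. B * F A B T)" for F
  proof (rule spanned.cong)
    show "spanned \<omega> (\<lambda>A B T. scale2 (tr2 (A * B)) (F A B T)
        - scale2 (tr2 A) (scale2 (tr2 B) (F A B T)) + scale2 (tr2 B) (A * F A B T)
        + scale2 (tr2 A) (B * F A B T) - A * (B * F A B T))"
      by (intro closed F BF)
    show "B * (A * F A B T) = scale2 (tr2 (A * B)) (F A B T)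
        - scale2 (tr2 A) (scale2 (tr2 B) (F A B T)) + scale2 (tr2 B) (A * F A B T)
        + scale2 (tr2 A) (B * F A B T) - A * (B * F A B T)" for A B T
      using arg_cong[OF anticommutator[of B A], of "\<lambda>M. M * F A B T"]
      by (simp add: scale2_distrib left_diff_distrib distrib_right mult.assoc)
  qed
  {
    case gen1 show ?case using spanned.genB by simp
  next
    case genA show ?case using BA[OF spanned.gen1] spanned.genB by simp
  next
    case genB show ?case using BB[OF spanned.gen1] spanned.genB by simp
  next
    case genAB show ?case by (rule BA[OF spanned.genB]) (use BB[OF spanned.gen1] spanned.genB in simp)
  next
    case genT show ?case by (rule spanned.genBT)
  next
    case genAT show ?case by (rule BA[OF spanned.genT spanned.genBT])
  next
    case genBT show ?case by (rule BB[OF spanned.genT spanned.genBT])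
  next
    case genABT
    show ?case
      using BA[OF spanned.genBT BB[OF spanned.genT spanned.genBT]] by (simp add: mult.assoc)
  next
    case (add F G) then show ?case using spanned.add by (simp add: distrib_left)
  next
    case (scale f F) then show ?case using spanned.scale by simp
  next
    case (cong F G) show ?case by (rule spanned.cong[OF cong.IH]) (simp add: cong.hyps)
  }
qed

lemma spanned_adj:
  assumes "spanned \<omega> F"
  shows "spanned \<omega> (\<lambda>A B T. adj2 A * F A B T)" and "spanned \<omega> (\<lambda>A B T. adj2 B * F A B T)"
  using spanned_diff[OF spanned_scale_traces(1)[OF assms] spanned_A[OF assms]]
    spanned_diff[OF spanned_scale_traces(2)[OF assms] spanned_B[OF assms]]
  by (simp_all add: adj2_eq left_diff_distrib)

text \<open>The monodromy relations move \<open>T\<close> to the right past \<open>A\<close> and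
  \<open>B\<close>. The words in \<open>A\<close> and \<open>B\<close> left in front are absorbed by
  the previous closure lemmas, and \<open>T * T\<close> is reduced by Cayley-Hamilton.\<close>

lemma spanned_T:
  assumes "spanned \<omega> F"
  shows "spanned \<omega> (\<lambda>A B T. T * F A B T)"
  using assms
proof induction
  note closed = spanned_A spanned_B spanned_adj
  have TA: "spanned \<omega> (\<lambda>A B T. T * (A * F A B T))" if TF: "spanned \<omega> (\<lambda>A B T. T * F A B T)" for F
  proof (rule spanned.cong)
    show "spanned \<omega> (\<lambda>A B T. adj2 B * (adj2 A * (adj2 B * (T * F A B T))))"
      by (intro closed TF)
    show "T * (A * F A B T) = adj2 B * (adj2 A * (adj2 B * (T * F A B T)))"
      if "on_curve \<omega> A B T" for A B T
      using is_rep_relations(1)[of A B T] that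
      by (simp add: on_curve_def mult.assoc[symmetric] adj2_mult)
  qed
  have TB: "spanned \<omega> (\<lambda>A B T. T * (B * F A B T))" if TF: "spanned \<omega> (\<lambda>A B T. T * F A B T)" for F
  proof (rule spanned.cong)
    show "spanned \<omega> (\<lambda>A B T. B * (A * (adj2 B * (adj2 A * (adj2 B *
        (adj2 B * (adj2 A * (adj2 B * (adj2 B * (adj2 A * (adj2 B * (T * F A B T))))))))))))"
      by (intro closed TF)
    show "T * (B * F A B T) = B * (A * (adj2 B * (adj2 A * (adj2 B *
        (adj2 B * (adj2 A * (adj2 B * (adj2 B * (adj2 A * (adj2 B * (T * F A B T)))))))))))"
      if "on_curve \<omega> A B T" for A B T
      using is_rep_relations(2)[of A B T] that
      by (simp add: on_curve_def mult.assoc[symmetric] adj2_mult)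
  qed
  have TT: "spanned \<omega> (\<lambda>A B T. T * T)"
    by (rule spanned.cong[OF spanned_diff[OF spanned_scale_traces(4)[OF spanned.genT] spanned.gen1]])
      (simp add: sl2_square on_curve_det)
  have T1: "spanned \<omega> (\<lambda>A B T. T * 1)" using spanned.genT by simp
  {
    case gen1 show ?case by (rule T1)
  next
    case genA show ?case using TA[OF T1] by simp
  next
    case genB show ?case using TB[OF T1] by simp
  next
    case genAB show ?case using TA[OF TB[OF T1]] by simp
  next
    case genT show ?case by (rule TT)
  next
    case genAT show ?case by (rule TA[OF TT])
  next
    case genBT show ?case by (rule TB[OF TT])
  next
    case genABT show ?case using TA[OF TB[OF TT]] by (simp add: mult.assoc)
  next
    case (add F G) then show ?case using spanned.add by (simp add: distrib_left)
  next
    case (scale f F) then show ?case using spanned.scale by simp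
  next
    case (cong F G) show ?case by (rule spanned.cong[OF cong.IH]) (simp add: cong.hyps)
  }
qed

lemma spanned_weval: "spanned \<omega> (\<lambda>A B T. weval A B T w)"
proof (induction w)
  case Nil show ?case using spanned.gen1 by simp
next
  case (Cons p w)
  obtain g b where p: "p = (g, b)" by (cases p)
  have "spanned \<omega> (\<lambda>A B T. adj2 T * weval A B T w)"
    using spanned_diff[OF spanned_scale_traces(4)[OF Cons] spanned_T[OF Cons]]
    by (simp add: adj2_eq left_diff_distrib)
  then show ?case
    using spanned_A[OF Cons] spanned_B[OF Cons] spanned_T[OF Cons] spanned_adj[OF Cons]
    by (cases g; cases b) (simp_all add: p)
qed

lemma trace_polyfun:
  obtains f where "\<And>w. polyfun (insert \<omega> \<rat>) (f w)"
    "\<And>w A B T. on_curve \<omega> A B T \<Longrightarrow> tr2 (weval A B T w) = f w (tr2 (A * B)) (tr2 B)"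
  using spanned_trace[OF spanned_weval] by metis

section \<open>An explicit family of representations\<close>

text \<open>Reverses the third part of \<open>is_rep_relations\<close>: for explicit matrices the
  form with short products is the one that can be checked by expansion.\<close>

lemma is_repI:
  assumes d: "det2 A = 1" "det2 B = 1" "det2 T = 1"
    and 1: "T * A = adj2 (B * A * B) * T" and 3: "B * T * A * B = T * A * A * A"
  shows "is_rep A B T"
proof -
  let ?A = "adj2 (B * A * B)"
  have "B * A * (B * ?A * (T * B)) = B * A * (B * T * A * B)"
    by (metis 1 mult.assoc)
  also have "\<dots> = B * A * (T * A * A * A)"
    by (simp only: 3)
  also have "T * A * A * A = ?A * ?A * ?A * T"
    by (metis 1 mult.assoc)
  also have "B * A * (B * ?A * (T * B)) = T * B"
    by (simp add: adj2_mult mult.assoc sl2_inverse d)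
  finally have 2: "T * B = B * A * (?A * ?A * ?A * T)" .
  show ?thesis
    unfolding is_rep_iff using d 1 2 by (simp add: mult.assoc sl2_inverse)
qed

text \<open>The matrices are obtained by making the commutator direction of \<open>A\<close> and \<open>B\<close> diagonal, which
  gives \<open>A\<close> and \<open>B\<close> constant diagonals, and solving for \<open>T\<close> from its four traces. The parameters
  are \<open>s = z / 2\<close>, \<open>t = 1 / s\<close>, \<open>v = 1 / sqrt 2\<close> and \<open>m = y * v\<close>; the names are chosen so that
  \<open>s\<close> and \<open>t\<close> are adjacent in the term order and the relation \<open>s * t = 1\<close> rewrites.\<close>

lemma explicit_rep:
  fixes m s v t \<omega> :: complex
  assumes m: "m * m = 1 + t * t" and v: "v * v = 1 / 2" and ts: "t * s = 1" and \<omega>: "\<omega> * \<omega> = -1"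
  defines "A \<equiv> Mat2 (v * m * s) ((s * s - 1) * (1 - v)) (1 + v) (v * m * s)"
    and "B \<equiv> Mat2 (v * m) ((s - t) * v) (- (t * v)) (v * m)"
    and "T \<equiv> Mat2 (\<omega> * s * s * (1 + 2 * v)) (- (\<omega> * s * m * (s * s - 1))) (\<omega> * s * m)
      (\<omega> * s * s * (1 - 2 * v))"
  shows "on_curve \<omega> A B T" "tr2 B = 2 * v * m" "tr2 (A * B) = 2 * s"
proof -
  \<comment> \<open>Each relation is repeated with a trailing factor \<open>u\<close>, because in
    right-nested products the two factors to be rewritten are followed by a remainder.\<close>
  have m': "m * (m * u) = u + t * (t * u)" for u
    using m by (simp add: mult.assoc[symmetric] distrib_right)
  have v': "v * (v * u) = u / 2" for u
    using v by (simp add: mult.assoc[symmetric])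
  have ts': "s * (t * u) = u" "s * t = 1" for u
    using ts by (simp_all add: mult.assoc[symmetric] mult.commute)
  have \<omega>': "\<omega> * (\<omega> * u) = - u" for u
    using \<omega> by (simp add: mult.assoc[symmetric])
  note rules = m m' v v' ts' \<omega> \<omega>'
  have d: "det2 A = 1" "det2 B = 1" "det2 T = 1"
    by (simp_all add: A_def B_def T_def det2_def algebra_simps rules, simp_all add: field_simps)
  show tB: "tr2 B = 2 * v * m" by (simp add: tr2_def B_def)
  show tAB: "tr2 (A * B) = 2 * s"
    by (simp add: A_def B_def tr2_def mat2_defs algebra_simps rules; simp add: field_simps)
  have tA: "tr2 A = 2 * (v * m * s)"
    by (simp add: A_def tr2_def)
  have "tr2 (B * A * B) = tr2 A"
    by (simp add: sl2_BAB[OF d(1,2)] tr2_simps tAB tB tA)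
  \<comment> \<open>The linear expression \<open>2 * x - z * B - A\<close> of
    \<open>rep_trace_relations\<close>, with \<open>x = 2 * v * m * s\<close> and
    \<open>z = 2 * s\<close>.\<close>
  then have "adj2 (B * A * B) = scale2 (4 * (v * m * s)) 1 - scale2 (2 * s) B - A"
    by (simp only: adj2_eq[of "B * A * B"])
       (simp only: sl2_BAB[OF d(1,2)] adj2_eq[of A] tA tAB,
         simp add: scale2_def mat2_defs A_def B_def algebra_simps)
  then have "T * A = adj2 (B * A * B) * T"
    by (simp add: A_def B_def T_def mat2_defs scale2_def algebra_simps rules; simp add: field_simps)
  moreover have "B * T * A * B = T * A * A * A"
    by (simp add: A_def B_def T_def tr2_def mat2_defs algebra_simps rules; simp add: field_simps)
  ultimately have "is_rep A B T"
    by (intro is_repI d)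
  moreover have "tr2 (A * T) = \<omega> * (2 * s) * (2 * v * m) / 2"
    "tr2 (B * T) = \<omega> * ((2 * s)\<^sup>2 * (2 * v * m) / 2 - 2 * v * m)"
    "tr2 T = \<omega> * (2 * s)\<^sup>2 / 2" "(2 * s)\<^sup>2 * ((2 * v * m)\<^sup>2 - 2) = 8"
    by (simp_all add: A_def B_def T_def tr2_def mat2_defs power2_eq_square algebra_simps rules)
  moreover have "tr2 (A * B * T) = \<omega> * (2 * s)"
    by (simp add: A_def B_def T_def tr2_def mat2_defs algebra_simps rules; simp add: field_simps)
  ultimately show "on_curve \<omega> A B T"
    unfolding on_curve_def Let_def tB tAB tA by (simp add: mult.commute mult.left_commute)
qed


lemma exists_rep_on_curve:
  assumes V: "z\<^sup>2 * (y\<^sup>2 - 2) = 8" and \<omega>: "\<omega> * \<omega> = -1"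
  obtains A B T where "on_curve \<omega> A B T" "tr2 (A * B) = z" "tr2 B = y"
proof -
  have z0: "z \<noteq> 0" using V by auto
  obtain v :: complex where v: "v * v = 1 / 2"
    using power2_csqrt[of "1/2"] by (metis power2_eq_square)
  \<comment> \<open>The hypothesis on \<open>m = y * v\<close> and \<open>t = 2 / z\<close> of
    \<open>explicit_rep\<close> is the curve equation in the form
    \<open>y^2 = 2 + 8 / z^2\<close>.\<close>
  have "y * v * (y * v) = 1 + 2 / z * (2 / z)"
  proof -
    have "y * v * (y * v) = y\<^sup>2 * (v * v)" by (simp add: power2_eq_square)
    also have "y\<^sup>2 = 2 + 8 / z\<^sup>2" using V z0 by (simp add: field_simps)
    finally show ?thesis by (simp add: v power2_eq_square algebra_simps)
  qed
  note rep = explicit_rep[OF this v _ \<omega>, of "z / 2"]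
  have "2 * v * (y * v) = 2 * (v * v) * y" by (simp add: algebra_simps)
  then have "2 * v * (y * v) = y" by (simp add: v)
  with rep z0 show thesis
    by (intro that) (simp_all only:, simp_all)
qed

section \<open>Faithful representations are not degenerate\<close>

text \<open>Subtracting the scalars \<open>a, b = \<plusminus>1\<close> leaves two nilpotent
  matrices, and the condition on \<open>A * B\<close> says that their product has trace 0. Two such
  nilpotents are proportional.\<close>

lemma parabolic_commute:
  assumes A: "det2 A = 1" "(tr2 A)\<^sup>2 = 4" and B: "det2 B = 1" "(tr2 B)\<^sup>2 = 4"
    and AB: "2 * tr2 (A * B) = tr2 A * tr2 B"
  shows "A * B = B * A"
proof -
  define a b where "a = tr2 A / 2" and "b = tr2 B / 2"
  define p q r p' q' r' where "p = (e11 A - e22 A) / 2" and "q = e12 A" and "r = e21 A"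
    and "p' = (e11 B - e22 B) / 2" and "q' = e12 B" and "r' = e21 B"
  note defs = p_def q_def r_def p'_def q'_def r'_def
  have A': "A = Mat2 (a + p) q r (a - p)" and B': "B = Mat2 (b + p') q' r' (b - p')"
    by (simp_all add: defs a_def b_def tr2_def mat2.expand field_simps)
  have ab: "a * a = 1" "b * b = 1"
    using A(2) B(2) by (simp_all add: a_def b_def power2_eq_square)
  have 1: "p * p = - (q * r)"
    using A(1) ab(1) unfolding A' by (simp add: det2_def eq_neg_iff_add_eq_0 algebra_simps)
  have 2: "p' * p' = - (q' * r')"
    using B(1) ab(2) unfolding B' by (simp add: det2_def eq_neg_iff_add_eq_0 algebra_simps)
  have "2 * (2 * (a * b) + 2 * (p * p') + q * r' + r * q') = 2 * tr2 (A * B)"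
    unfolding A' B' by (simp add: tr2_def mat2_defs algebra_simps)
  also have "\<dots> = 2 * (2 * (a * b))"
    by (simp add: AB a_def b_def)
  finally have "2 * (p * p') + (q * r' + r * q') = 0"
    by (simp only: mult_cancel_left) (simp add: add.assoc)
  then have 3: "2 * (p * p') = - (q * r' + r * q')"
    by (simp only: eq_neg_iff_add_eq_0)
  \<comment> \<open>Proportionality of \<open>(p, q, r)\<close> and \<open>(p', q', r')\<close>:
    each of the three minors has square 0 by \<open>1\<close>, \<open>2\<close> and
    \<open>3\<close>.\<close>
  have "(p * q' - q * p') * (p * q' - q * p') = (p * p) * q' * q' - (2 * (p * p')) * q * q' + (p' * p') * q * q"
    by (simp add: algebra_simps)
  also have "\<dots> = 0"
    by (simp only: 1 2 3) (simp add: algebra_simps)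
  finally have pq: "p * q' = q * p'" by simp
  have "(p * r' - r * p') * (p * r' - r * p') = (p * p) * r' * r' - (2 * (p * p')) * r * r' + (p' * p') * r * r"
    by (simp add: algebra_simps)
  also have "\<dots> = 0"
    by (simp only: 1 2 3) (simp add: algebra_simps)
  finally have pr: "p * r' = r * p'" by simp
  have "(q * r' - r * q') * (q * r' - r * q') = (q * r' + r * q') * (q * r' + r * q') - 4 * (q * r) * (q' * r')"
    by (simp add: algebra_simps)
  also have "\<dots> = (2 * (p * p')) * (2 * (p * p')) - 4 * (p * p) * (p' * p')"
    by (simp only: 1 2 3) (simp add: algebra_simps)
  also have "\<dots> = 0" by (simp add: algebra_simps)
  finally have qr: "q * r' = r * q'" by simp
  show ?thesis
    unfolding A' B' using pq pr qr by (simp add: mat2_defs algebra_simps)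
qed

text \<open>A degenerate trace forces an equation between words; by faithfulness it holds in the
  group, hence in every representation, and an explicit one refutes it.\<close>

lemma faithful_nondegenerate:
  assumes rep: "is_rep A B T"
    and inj: "\<And>u v. weval A B T u = weval A B T v \<Longrightarrow> word_eq relN u v"
  shows "tr2 B \<noteq> 0" and "(tr2 (A * B))\<^sup>2 \<noteq> 4"
proof -
  have d: "det2 A = 1" "det2 B = 1" using rep by (auto simp: is_rep_def)
  \<comment> \<open>The point \<open>z = 1\<close>, \<open>y^2 = 10\<close> of the curve serves as
    the test representation.\<close>
  define y0 where "y0 = complex_of_real (sqrt 10)"
  have y0: "y0\<^sup>2 = 10" by (simp add: y0_def flip: of_real_power)
  obtain A0 B0 T0 where 0: "on_curve \<i> A0 B0 T0" "tr2 (A0 * B0) = 1" "tr2 B0 = y0"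
    using exists_rep_on_curve[of 1 y0 \<i>] y0 by auto
  have rep0: "is_rep A0 B0 T0" and d0: "det2 A0 = 1" "det2 B0 = 1" and x0: "tr2 A0 = y0 / 2"
    using 0 by (auto simp: on_curve_def Let_def is_rep_def)
  show nz: "tr2 B \<noteq> 0"
  proof
    assume "tr2 B = 0"
    then have "B * B = - 1" using sl2_square[OF d(2)] by simp
    \<comment> \<open>So \<beta> has fourth power 1 in the group, whereas the fourth power of
      \<open>B0\<close> has trace \<open>(10 - 2)^2 - 2 = 62\<close>.\<close>
    then have "weval A B T (wb @ wb @ wb @ wb) = weval A B T []"
      by (simp add: mult.assoc[symmetric])
    then have "weval A0 B0 T0 (wb @ wb @ wb @ wb) = 1"
      using weval_cong[OF rep0 inj] by (metis weval_simps(1))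
    then have "tr2 (B0 * (B0 * (B0 * B0))) = 2"
      by (simp add: tr2_simps)
    moreover have "tr2 (B0 * (B0 * (B0 * B0))) = (y0\<^sup>2 - 2)\<^sup>2 - 2"
      by (simp add: sl2_square[OF d0(2)] sl2_square_left[OF d0(2)] tr2_simps 0(3) power2_eq_square algebra_simps)
    ultimately show False by (simp add: y0)
  qed
  show "(tr2 (A * B))\<^sup>2 \<noteq> 4"
  proof
    assume z: "(tr2 (A * B))\<^sup>2 = 4"
    \<comment> \<open>All three traces now square to 4, so \<alpha> and \<beta> commute; but the
      commutator of \<open>A0\<close> and \<open>B0\<close> has trace 13/2 instead of 2.\<close>
    with rep_dichotomy[OF rep] nz have y: "(tr2 B)\<^sup>2 = 4" by (simp add: algebra_simps)
    have x: "2 * tr2 A = tr2 B * tr2 (A * B)" by (rule rep_fibre_equations(1)[OF rep])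
    have "4 * (tr2 A)\<^sup>2 = (tr2 B)\<^sup>2 * (tr2 (A * B))\<^sup>2"
      using arg_cong[OF x, of "\<lambda>u. u\<^sup>2"] by (simp add: power_mult_distrib)
    then have x2: "(tr2 A)\<^sup>2 = 4" by (simp add: y z)
    have "2 * (tr2 A * tr2 B) = (tr2 B)\<^sup>2 * tr2 (A * B)"
      using arg_cong[OF x, of "\<lambda>u. u * tr2 B"] by (simp add: power2_eq_square algebra_simps)
    then have "2 * tr2 (A * B) = tr2 A * tr2 B" by (simp add: y)
    from parabolic_commute[OF d(1) x2 d(2) y this]
    have "weval A B T (wa @ wb) = weval A B T (wb @ wa)" by simp
    then have "A0 * B0 = B0 * A0"
      using weval_cong[OF rep0 inj] by (metis weval_append weval_generators(1,2))
    then have "A0 * B0 * adj2 A0 * adj2 B0 = 1"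
      by (simp add: mult.assoc sl2_inverse d0)
    then have "2 = (y0 / 2)\<^sup>2 + y0\<^sup>2 + 1 - y0 / 2 * y0 - 2"
      using tr2_commutator[OF d0] by (simp add: 0 x0 tr2_simps)
    also have "\<dots> = - y0\<^sup>2 / 4 + y0\<^sup>2 - 1"
      by (simp add: power2_eq_square field_simps)
    finally show False by (simp add: y0)
  qed
qed

section \<open>The irreducible curves of characters\<close>

lemma gen_algebra_const: "c \<in> K \<Longrightarrow> (\<lambda>x\<in>X. c) \<in> gen_algebra X K S"
  by (auto simp: gen_algebra_def intro: generate_ring.incl)

lemma gen_algebra_incl: "f \<in> S \<Longrightarrow> f \<in> gen_algebra X K S"
  by (auto simp: gen_algebra_def intro: generate_ring.incl)

lemma gen_algebra_add:
  assumes "(\<lambda>x\<in>X. f x) \<in> gen_algebra X K S" "(\<lambda>x\<in>X. g x) \<in> gen_algebra X K S"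
  shows "(\<lambda>x\<in>X. f x + g x) \<in> gen_algebra X K S"
proof -
  have "(\<lambda>x\<in>X. f x + g x) = (\<lambda>x\<in>X. f x) \<oplus>\<^bsub>fun_ring X\<^esub> (\<lambda>x\<in>X. g x)"
    by (auto simp: fun_ring_simps)
  then show ?thesis using assms by (simp add: gen_algebra_def generate_ring.eng_add)
qed

lemma gen_algebra_mult:
  assumes "(\<lambda>x\<in>X. f x) \<in> gen_algebra X K S" "(\<lambda>x\<in>X. g x) \<in> gen_algebra X K S"
  shows "(\<lambda>x\<in>X. f x * g x) \<in> gen_algebra X K S"
proof -
  have "(\<lambda>x\<in>X. f x * g x) = (\<lambda>x\<in>X. f x) \<otimes>\<^bsub>fun_ring X\<^esub> (\<lambda>x\<in>X. g x)"
    by (auto simp: fun_ring_simps)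
  then show ?thesis using assms by (simp add: gen_algebra_def generate_ring.eng_mult)
qed

lemma gen_algebra_diff:
  assumes "(\<lambda>x\<in>X. f x) \<in> gen_algebra X K S" "(\<lambda>x\<in>X. g x) \<in> gen_algebra X K S" "-1 \<in> K"
  shows "(\<lambda>x\<in>X. f x - g x) \<in> gen_algebra X K S"
  using gen_algebra_add[OF assms(1) gen_algebra_mult[OF gen_algebra_const[OF assms(3)] assms(2)]]
  by simp

lemma gen_algebra_power:
  assumes "(\<lambda>x\<in>X. f x) \<in> gen_algebra X K S" "1 \<in> K"
  shows "(\<lambda>x\<in>X. f x ^ n) \<in> gen_algebra X K S"
proof (induction n)
  case 0 show ?case using gen_algebra_const[OF assms(2), of X S] by (simp only: power_0)
next
  case (Suc n) show ?case using gen_algebra_mult[OF assms(1) Suc] by (simp only: power_Suc)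
qed

lemma fun_ring_uminus:
  assumes "f \<in> extensional X"
  shows "\<ominus>\<^bsub>fun_ring X\<^esub> f = (\<lambda>x\<in>X. - f x)"
proof -
  interpret cring "fun_ring X" by (rule cring_fun_ring)
  have "(\<lambda>x\<in>X. - f x) \<oplus>\<^bsub>fun_ring X\<^esub> f = \<zero>\<^bsub>fun_ring X\<^esub>"
    by (auto simp: fun_ring_simps)
  then show ?thesis
    using assms by (intro minus_equality) (auto simp: fun_ring_simps)
qed

text \<open>With 1 and -1 among the constants, the unit and negation steps of
  \<open>generate_ring\<close> become instances of the constant and product cases.\<close>

lemma gen_algebra_induct [consumes 3, case_names const incl add mult]:
  assumes f: "f \<in> gen_algebra X K S" and K: "1 \<in> K" "-1 \<in> K"
    and const: "\<And>c. c \<in> K \<Longrightarrow> P (\<lambda>x\<in>X. c)" and incl: "\<And>g. g \<in> S \<Longrightarrow> P g"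
    and add: "\<And>g h. P g \<Longrightarrow> P h \<Longrightarrow> P (\<lambda>x\<in>X. g x + h x)"
    and mult: "\<And>g h. P g \<Longrightarrow> P h \<Longrightarrow> P (\<lambda>x\<in>X. g x * h x)"
    and S: "S \<subseteq> extensional X"
  shows "P f"
proof -
  interpret cring "fun_ring X" by (rule cring_fun_ring)
  have sub: "(\<lambda>c. \<lambda>x\<in>X. c) ` K \<union> S \<subseteq> carrier (fun_ring X)"
    using S by (auto simp: fun_ring_simps)
  have "P f \<and> f \<in> extensional X"
    using f unfolding gen_algebra_def
  proof induction
    case one show ?case
      using const[OF K(1)] by (simp only: fun_ring_simps restrict_extensional simp_thms)
  next
    case (incl h) then show ?case using const assms(5) S by auto
  next
    case (a_inv h)
    then have "\<ominus>\<^bsub>fun_ring X\<^esub> h = (\<lambda>x\<in>X. (\<lambda>x\<in>X. -1) x * h x)"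
      by (auto simp: fun_ring_uminus)
    with mult[OF const[OF K(2)], of h] a_inv show ?case
      by (simp only: restrict_extensional simp_thms)
  next
    case (eng_add g h)
    with add[of g h] show ?case by (simp only: fun_ring_simps restrict_extensional simp_thms)
  next
    case (eng_mult g h)
    with mult[of g h] show ?case by (simp only: fun_ring_simps restrict_extensional simp_thms)
  qed
  then show ?thesis ..
qed

text \<open>Coordinates are indexed by words, to match \<open>weval\<close>, instead of by group
  elements.\<close>

definition coord :: "gen word \<Rightarrow> char_fun \<Rightarrow> complex" where
  "coord w \<psi> = \<psi> (word_class relN w)"

lemma Ifun_word: "Ifun X (word_class relN w) = (\<lambda>\<psi>\<in>X. coord w \<psi>)"
  by (simp add: Ifun_def coord_def)

lemma carrier_piN: "carrier piN = range (word_class relN)"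
  by (simp add: piN_def presented_group_def)

lemma coord_in_gen_algebra: "(\<lambda>\<psi>\<in>X. coord w \<psi>) \<in> gen_algebra X K (Ifun X ` carrier piN)"
  by (intro gen_algebra_incl) (auto simp: carrier_piN Ifun_word[symmetric])

definition curve_chars :: "complex \<Rightarrow> char_fun set" where
  "curve_chars \<omega> = {\<psi> \<in> XN. \<exists>A B T. on_curve \<omega> A B T \<and>
     (\<forall>w. coord w \<psi> = tr2 (weval A B T w))}"

abbreviation yc :: "char_fun \<Rightarrow> complex" where "yc \<equiv> coord wb"
abbreviation zc :: "char_fun \<Rightarrow> complex" where "zc \<equiv> coord (wa @ wb)"

definition on_V :: "complex \<Rightarrow> complex \<Rightarrow> bool" where
  "on_V z y \<longleftrightarrow> z\<^sup>2 * (y\<^sup>2 - 2) = 8"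

text \<open>Apart from \<open>is_rep\<close>, the predicate \<open>on_curve\<close> speaks only of
  traces. Hence any representation with the given character can be used, and membership is a system
  of polynomial equations in the character.\<close>

lemma curve_chars_iff:
  "\<psi> \<in> curve_chars \<omega> \<longleftrightarrow> \<psi> \<in> XN \<and> on_V (zc \<psi>) (yc \<psi>) \<and> coord wa \<psi> = yc \<psi> * zc \<psi> / 2 \<and>
     coord wt \<psi> = \<omega> * (zc \<psi>)\<^sup>2 / 2 \<and> coord (wa @ wt) \<psi> = \<omega> * zc \<psi> * yc \<psi> / 2 \<and>
     coord (wb @ wt) \<psi> = \<omega> * ((zc \<psi>)\<^sup>2 * yc \<psi> / 2 - yc \<psi>) \<and> coord (wa @ wb @ wt) \<psi> = \<omega> * zc \<psi>"
    (is "?L \<longleftrightarrow> ?R")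
proof
  assume ?L
  then obtain A B T where "\<psi> \<in> XN" "on_curve \<omega> A B T" "\<And>w. coord w \<psi> = tr2 (weval A B T w)"
    by (auto simp: curve_chars_def)
  then show ?R by (simp add: on_curve_def Let_def on_V_def mult.assoc)
next
  assume R: ?R
  then obtain A B T where AB: "is_rep A B T" "\<And>w. coord w \<psi> = tr2 (weval A B T w)"
    using XN_E[of \<psi>] by (auto simp: coord_def)
  with R have "on_curve \<omega> A B T"
    unfolding on_curve_def Let_def by (simp add: on_V_def mult.assoc)
  with R AB show ?L by (auto simp: curve_chars_def)
qed

lemma closed_zero_sets:
  assumes "\<And>f. f \<in> F \<Longrightarrow> (\<lambda>\<psi>\<in>XN. f \<psi>) \<in> gen_algebra XN UNIV (Ifun XN ` carrier piN)"
  shows "zariski_closed {\<psi> \<in> XN. \<forall>f\<in>F. f \<psi> = 0}"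
  unfolding zariski_closed_def
  by (rule exI[of _ "(\<lambda>f. \<lambda>\<psi>\<in>XN. f \<psi>) ` F"]) (use assms in auto)

lemma closed_zero_set:
  assumes "(\<lambda>\<psi>\<in>XN. f \<psi>) \<in> gen_algebra XN UNIV (Ifun XN ` carrier piN)"
  shows "zariski_closed {\<psi> \<in> XN. f \<psi> = 0}"
  using closed_zero_sets[of "{f}"] assms by simp

lemmas regular_intros = gen_algebra_diff gen_algebra_mult gen_algebra_power gen_algebra_add
  gen_algebra_const coord_in_gen_algebra UNIV_I

lemma closed_curve_chars: "zariski_closed (curve_chars \<omega>)"
proof -
  \<comment> \<open>Halves are written as constant factors, so that the closure rules for sums and
    products apply.\<close>
  define F :: "(char_fun \<Rightarrow> complex) set" where "F = {\<lambda>\<psi>. (zc \<psi>)\<^sup>2 * ((yc \<psi>)\<^sup>2 - 2) - 8,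
    \<lambda>\<psi>. coord wa \<psi> - 1/2 * (yc \<psi> * zc \<psi>), \<lambda>\<psi>. coord wt \<psi> - \<omega>/2 * (zc \<psi>)\<^sup>2,
    \<lambda>\<psi>. coord (wa @ wt) \<psi> - \<omega>/2 * (zc \<psi> * yc \<psi>),
    \<lambda>\<psi>. coord (wb @ wt) \<psi> - \<omega> * (1/2 * ((zc \<psi>)\<^sup>2 * yc \<psi>) - yc \<psi>),
    \<lambda>\<psi>. coord (wa @ wb @ wt) \<psi> - \<omega> * zc \<psi>}"
  have "curve_chars \<omega> = {\<psi> \<in> XN. \<forall>f\<in>F. f \<psi> = 0}"
    by (auto simp: curve_chars_iff F_def on_V_def)
  moreover have "zariski_closed {\<psi> \<in> XN. \<forall>f\<in>F. f \<psi> = 0}"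
  proof (rule closed_zero_sets)
    fix f assume "f \<in> F"
    then show "(\<lambda>\<psi>\<in>XN. f \<psi>) \<in> gen_algebra XN UNIV (Ifun XN ` carrier piN)"
      unfolding F_def by (elim insertE emptyE; hypsubst) (intro regular_intros)+
  qed
  ultimately show ?thesis by simp
qed

lemma curve_chars_coord:
  obtains f where "\<And>w. polyfun (insert \<omega> \<rat>) (f w)"
    "\<And>w \<psi>. \<psi> \<in> curve_chars \<omega> \<Longrightarrow> coord w \<psi> = f w (zc \<psi>) (yc \<psi>)"
proof -
  obtain f where f: "\<And>w. polyfun (insert \<omega> \<rat>) (f w)"
    "\<And>w A B T. on_curve \<omega> A B T \<Longrightarrow> tr2 (weval A B T w) = f w (tr2 (A * B)) (tr2 B)"
    using trace_polyfun by blast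
  have "coord w \<psi> = f w (zc \<psi>) (yc \<psi>)" if \<psi>: "\<psi> \<in> curve_chars \<omega>" for w \<psi>
  proof -
    obtain A B T where AB: "on_curve \<omega> A B T" "\<And>w. coord w \<psi> = tr2 (weval A B T w)"
      using \<psi> by (auto simp: curve_chars_def)
    have "zc \<psi> = tr2 (A * B)" "yc \<psi> = tr2 B" by (simp_all add: AB(2))
    then show ?thesis using f(2)[OF AB(1)] by (simp only: AB(2))
  qed
  with f(1) show thesis by (rule that)
qed

text \<open>Applied with all complex constants to study Zariski closed sets, and with rational
  constants to study \<open>T_Q\<close>.\<close>

lemma gen_algebra_polyfun:
  assumes f: "f \<in> gen_algebra X K (Ifun X ` carrier piN)" and K: "\<rat> \<subseteq> K"
  obtains g where "polyfun (insert \<omega> K) g"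
    "\<And>\<psi>. \<psi> \<in> X \<Longrightarrow> \<psi> \<in> curve_chars \<omega> \<Longrightarrow> f \<psi> = g (zc \<psi>) (yc \<psi>)"
proof -
  obtain h where h: "\<And>w. polyfun (insert \<omega> \<rat>) (h w)"
    "\<And>w \<psi>. \<psi> \<in> curve_chars \<omega> \<Longrightarrow> coord w \<psi> = h w (zc \<psi>) (yc \<psi>)"
    using curve_chars_coord by blast
  have "1 \<in> K" "-1 \<in> K" using K by auto
  with f have "\<exists>g. polyfun (insert \<omega> K) g \<and> (\<forall>\<psi>\<in>X \<inter> curve_chars \<omega>. f \<psi> = g (zc \<psi>) (yc \<psi>))"
  proof (induction rule: gen_algebra_induct)
    case (const c)
    then show ?case by (intro exI[of _ "\<lambda>z y. c"]) (auto intro: polyfun.const)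
  next
    case (incl f)
    then obtain w where "f = (\<lambda>\<psi>\<in>X. coord w \<psi>)" by (auto simp: carrier_piN Ifun_word)
    moreover have "polyfun (insert \<omega> K) (h w)"
      by (rule polyfun_mono[OF h(1)]) (use K in auto)
    ultimately show ?case by (intro exI[of _ "h w"]) (auto simp: h(2)[symmetric])
  next
    case (add f g)
    obtain f' where f': "polyfun (insert \<omega> K) f'"
        "\<forall>\<psi>\<in>X \<inter> curve_chars \<omega>. f \<psi> = f' (zc \<psi>) (yc \<psi>)"
      using add(1) by (elim exE conjE)
    obtain g' where g': "polyfun (insert \<omega> K) g'"
        "\<forall>\<psi>\<in>X \<inter> curve_chars \<omega>. g \<psi> = g' (zc \<psi>) (yc \<psi>)"
      using add(2) by (elim exE conjE)
    show ?case
      by (rule exI, rule conjI[OF polyfun.add[OF f'(1) g'(1)]]) (use f'(2) g'(2) in auto)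
  next
    case (mult f g)
    obtain f' where f': "polyfun (insert \<omega> K) f'"
        "\<forall>\<psi>\<in>X \<inter> curve_chars \<omega>. f \<psi> = f' (zc \<psi>) (yc \<psi>)"
      using mult(1) by (elim exE conjE)
    obtain g' where g': "polyfun (insert \<omega> K) g'"
        "\<forall>\<psi>\<in>X \<inter> curve_chars \<omega>. g \<psi> = g' (zc \<psi>) (yc \<psi>)"
      using mult(2) by (elim exE conjE)
    show ?case
      by (rule exI, rule conjI[OF polyfun.mult[OF f'(1) g'(1)]]) (use f'(2) g'(2) in auto)
  qed (auto simp: Ifun_def)
  then show thesis using that by blast
qed

section \<open>Rational parametrisation and irreducibility\<close>

definition z_param :: "complex \<Rightarrow> complex" where "z_param s = s - 1 / s"
text \<open>With \<open>r = sqrt 2\<close> the curve is the hyperbola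
  \<open>(y * z / r)^2 - z^2 = 4\<close>; the parameter is \<open>s = (y * z / r + z) / 2\<close>,
  whose inverse is \<open>(y * z / r - z) / 2\<close>.\<close>

definition y_param :: "complex \<Rightarrow> complex" where "y_param s = complex_of_real (sqrt 2) * (s\<^sup>2 + 1) / (s\<^sup>2 - 1)"

lemma on_V_param:
  assumes "s \<noteq> 0" "s\<^sup>2 \<noteq> 1"
  shows "on_V (z_param s) (y_param s)"
proof -
  have s: "s\<^sup>2 - 1 \<noteq> 0" using assms by simp
  have r: "(complex_of_real (sqrt 2))\<^sup>2 = 2" by (simp flip: of_real_power)
  have "z_param s = (s\<^sup>2 - 1) / s"
    using assms by (simp add: z_param_def field_simps power2_eq_square)
  then have "(z_param s)\<^sup>2 = (s\<^sup>2 - 1)\<^sup>2 / s\<^sup>2" "(y_param s)\<^sup>2 = 2 * (s\<^sup>2 + 1)\<^sup>2 / (s\<^sup>2 - 1)\<^sup>2"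
    by (simp_all add: y_param_def power_divide power_mult_distrib r)
  moreover have "2 * (s\<^sup>2 + 1)\<^sup>2 / (s\<^sup>2 - 1)\<^sup>2 - 2 = (2 * (s\<^sup>2 + 1)\<^sup>2 - 2 * (s\<^sup>2 - 1)\<^sup>2) / (s\<^sup>2 - 1)\<^sup>2"
    using s by (simp add: diff_divide_distrib)
  moreover have "2 * (s\<^sup>2 + 1)\<^sup>2 - 2 * (s\<^sup>2 - 1)\<^sup>2 = 8 * s\<^sup>2"
    by (simp add: power2_eq_square algebra_simps)
  ultimately show ?thesis
    using assms s by (simp add: on_V_def)
qed

lemma on_V_paramE:
  assumes "on_V z y"
  obtains s where "s \<noteq> 0" "s\<^sup>2 \<noteq> 1" "z = z_param s" "y = y_param s"
proof -
  define r where "r = complex_of_real (sqrt 2)"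
  have r: "r * r = 2" by (simp add: r_def flip: of_real_mult)
  then have r0: "r \<noteq> 0" by auto
  have z0: "z \<noteq> 0" using assms by (auto simp: on_V_def)
  define s s' where "s = (y * z / r + z) / 2" and "s' = (y * z / r - z) / 2"
  have "s * s' = (y * y * z * z / (r * r) - z * z) / 4"
    by (simp add: s_def s'_def algebra_simps add_divide_distrib diff_divide_distrib)
  also have "\<dots> = 1"
    using assms by (simp add: r on_V_def power2_eq_square algebra_simps)
  finally have ss: "s * s' = 1" .
  then have s0: "s \<noteq> 0" and inv: "1 / s = s'"
    using inverse_unique[of s s'] by (auto simp: inverse_eq_divide)
  have z: "z = z_param s" unfolding z_param_def inv by (simp add: s_def s'_def field_simps)
  have s1: "s\<^sup>2 \<noteq> 1"
    using z z0 s0 by (auto simp: z_param_def power2_eq_square field_simps)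
  have "y * z = r * (s + 1 / s)"
    using r0 unfolding inv by (simp add: s_def s'_def field_simps)
  then have "y * (s\<^sup>2 - 1) = r * (s\<^sup>2 + 1)"
    using s0 by (simp add: z z_param_def field_simps power2_eq_square)
  then have "y = y_param s"
    using s1 by (simp add: y_param_def r_def field_simps)
  with s0 s1 z show thesis by (rule that)
qed

text \<open>The parametrisation has denominators \<open>s\<close> and \<open>s^2 - 1\<close>, so a
  power of their product clears those of any polynomial pulled back along it.\<close>

lemma polyfun_param:
  assumes "polyfun K g"
  shows "\<exists>P n. \<forall>s. s \<noteq> 0 \<longrightarrow> s\<^sup>2 \<noteq> 1 \<longrightarrow> g (z_param s) (y_param s) * (s * (s\<^sup>2 - 1)) ^ n = poly P s"
  using assms
proof induction
  case (const c)
  show ?case by (intro exI[of _ "[:c:]"] exI[of _ 0]) simp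
next
  case fst
  show ?case by (intro exI[of _ "([:-1, 0, 1:])\<^sup>2"] exI[of _ 1])
      (simp add: z_param_def field_simps power2_eq_square)
next
  case snd
  show ?case by (intro exI[of _ "[:0, complex_of_real (sqrt 2), 0, complex_of_real (sqrt 2):]"] exI[of _ 1])
      (simp add: y_param_def field_simps power2_eq_square)
next
  case (add f g)
  then obtain P n Q m where *:
    "\<And>s. s \<noteq> 0 \<Longrightarrow> s\<^sup>2 \<noteq> 1 \<Longrightarrow> f (z_param s) (y_param s) * (s * (s\<^sup>2 - 1)) ^ n = poly P s"
    "\<And>s. s \<noteq> 0 \<Longrightarrow> s\<^sup>2 \<noteq> 1 \<Longrightarrow> g (z_param s) (y_param s) * (s * (s\<^sup>2 - 1)) ^ m = poly Q s"
    by blast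
  define D :: "complex poly" where "D = [:0, 1:] * [:-1, 0, 1:]"
  have D: "poly D s = s * (s\<^sup>2 - 1)" for s by (simp add: D_def power2_eq_square algebra_simps)
  show ?case
    by (intro exI[of _ "P * D ^ m + Q * D ^ n"] exI[of _ "n + m"])
      (simp add: D *[symmetric] distrib_right power_add mult.assoc mult.commute mult.left_commute)
next
  case (mult f g)
  then obtain P n Q m where *:
    "\<And>s. s \<noteq> 0 \<Longrightarrow> s\<^sup>2 \<noteq> 1 \<Longrightarrow> f (z_param s) (y_param s) * (s * (s\<^sup>2 - 1)) ^ n = poly P s"
    "\<And>s. s \<noteq> 0 \<Longrightarrow> s\<^sup>2 \<noteq> 1 \<Longrightarrow> g (z_param s) (y_param s) * (s * (s\<^sup>2 - 1)) ^ m = poly Q s"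
    by blast
  show ?case
    by (intro exI[of _ "P * Q"] exI[of _ "n + m"])
      (simp add: *[symmetric] power_add mult.assoc mult.commute mult.left_commute)
qed

text \<open>The integral domain property behind irreducibility: two functions that are each nonzero
  somewhere on the curve are nonzero at a common point, because their numerators in \<open>s\<close>
  have finitely many zeros.\<close>

lemma polyfun_nonzero_product:
  assumes "polyfun K f" "polyfun K g" and "on_V z1 y1" "f z1 y1 \<noteq> 0" and "on_V z2 y2" "g z2 y2 \<noteq> 0"
  obtains z y where "on_V z y" "f z y \<noteq> 0" "g z y \<noteq> 0"
proof -
  obtain P n where P: "\<And>s. s \<noteq> 0 \<Longrightarrow> s\<^sup>2 \<noteq> 1 \<Longrightarrow> f (z_param s) (y_param s) * (s * (s\<^sup>2 - 1)) ^ n = poly P s"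
    using polyfun_param[OF assms(1)] by blast
  obtain Q m where Q: "\<And>s. s \<noteq> 0 \<Longrightarrow> s\<^sup>2 \<noteq> 1 \<Longrightarrow> g (z_param s) (y_param s) * (s * (s\<^sup>2 - 1)) ^ m = poly Q s"
    using polyfun_param[OF assms(2)] by blast
  obtain s1 where s1: "s1 \<noteq> 0" "s1\<^sup>2 \<noteq> 1" "z1 = z_param s1" "y1 = y_param s1" using on_V_paramE[OF assms(3)] .
  obtain s2 where s2: "s2 \<noteq> 0" "s2\<^sup>2 \<noteq> 1" "z2 = z_param s2" "y2 = y_param s2" using on_V_paramE[OF assms(5)] .
  have "poly P s1 \<noteq> 0" using P[OF s1(1,2)] assms(4) s1 by (metis mult_eq_0_iff power_eq_0_iff right_minus_eq)
  moreover have "poly Q s2 \<noteq> 0" using Q[OF s2(1,2)] assms(6) s2 by (metis mult_eq_0_iff power_eq_0_iff right_minus_eq)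
  \<comment> \<open>The last two factors exclude the parameter values where the parametrisation is
    undefined.\<close>
  ultimately have "P * Q * [:0, 1:] * [:-1, 0, 1:] \<noteq> 0"
    by (simp only: mult_eq_0_iff) auto
  then have "finite {s. poly (P * Q * [:0, 1:] * [:-1, 0, 1:]) s = 0}"
    by (rule poly_roots_finite)
  then obtain s where "poly (P * Q * [:0, 1:] * [:-1, 0, 1:]) s \<noteq> 0"
    using infinite_UNIV_char_0[where 'a = complex] by (metis (mono_tags, lifting) UNIV_eq_I mem_Collect_eq)
  then have s: "poly P s \<noteq> 0" "poly Q s \<noteq> 0" "s \<noteq> 0" "s\<^sup>2 \<noteq> 1"
    by (auto simp: power2_eq_square)
  show thesis
    by (rule that[OF on_V_param[OF s(3,4)]]) (use P[OF s(3,4)] Q[OF s(3,4)] s in auto)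
qed

lemma curve_chars_surj:
  assumes "on_V z y" "\<omega> * \<omega> = -1"
  obtains \<psi> where "\<psi> \<in> curve_chars \<omega>" "zc \<psi> = z" "yc \<psi> = y"
proof -
  obtain A B T where AB: "on_curve \<omega> A B T" "tr2 (A * B) = z" "tr2 B = y"
    using exists_rep_on_curve assms by (metis on_V_def)
  then have "is_rep A B T" by (simp add: on_curve_def)
  then obtain \<psi> where \<psi>: "\<psi> \<in> XN" "\<And>w. coord w \<psi> = tr2 (weval A B T w)"
    using XN_I by (metis coord_def)
  with AB show thesis
    by (intro that[of \<psi>]) (auto simp: curve_chars_def)
qed

text \<open>A closed set not containing the curve misses every point where some polynomial function,
  not identically zero on the curve, is nonzero. For two such sets there is a point where both
  functions are nonzero, so they cannot cover the curve.\<close>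

lemma irreducible_curve_chars:
  assumes \<omega>: "\<omega> * \<omega> = -1"
  shows "zariski_irreducible (curve_chars \<omega>)"
  unfolding zariski_irreducible_def
proof (intro conjI allI impI)
  have "on_V 2 2" by (simp add: on_V_def)
  then show "curve_chars \<omega> \<noteq> {}" using curve_chars_surj[OF _ \<omega>] by blast
next
  fix C D assume closed: "zariski_closed C" "zariski_closed D" and sub: "curve_chars \<omega> \<subseteq> C \<union> D"
  let ?R = "gen_algebra XN UNIV (Ifun XN ` carrier piN)"
  have XN: "curve_chars \<omega> \<subseteq> XN" by (auto simp: curve_chars_def)
  have witness: "\<exists>g. \<exists>\<psi>\<in>curve_chars \<omega>. polyfun UNIV g \<and> g (zc \<psi>) (yc \<psi>) \<noteq> 0 \<and>
      (\<forall>\<psi>'\<in>curve_chars \<omega>. g (zc \<psi>') (yc \<psi>') \<noteq> 0 \<longrightarrow> \<psi>' \<notin> E)"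
    if E: "zariski_closed E" "\<not> curve_chars \<omega> \<subseteq> E" for E
  proof -
    obtain F where F: "F \<subseteq> ?R" "E = {\<psi> \<in> XN. \<forall>f\<in>F. f \<psi> = 0}"
      using \<open>zariski_closed E\<close> by (auto simp: zariski_closed_def)
    then obtain f \<psi> where f: "f \<in> ?R" "f \<in> F" "\<psi> \<in> curve_chars \<omega>" "f \<psi> \<noteq> 0"
      using E(2) XN by blast
    obtain g where g: "polyfun (insert \<omega> UNIV) g"
      "\<And>\<psi>. \<psi> \<in> XN \<Longrightarrow> \<psi> \<in> curve_chars \<omega> \<Longrightarrow> f \<psi> = g (zc \<psi>) (yc \<psi>)"
      using gen_algebra_polyfun[OF f(1)] by blast
    then have "f \<psi> = g (zc \<psi>) (yc \<psi>)" if "\<psi> \<in> curve_chars \<omega>" for \<psi>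
      using that XN by blast
    moreover from this have "\<psi>' \<notin> E" if "\<psi>' \<in> curve_chars \<omega>" "g (zc \<psi>') (yc \<psi>') \<noteq> 0" for \<psi>'
      using that f(2) unfolding F(2) by (metis (mono_tags, lifting) mem_Collect_eq)
    ultimately show ?thesis
      using g(1) f(3,4) by (intro exI[of _ g] bexI[of _ \<psi>]) auto
  qed
  show "curve_chars \<omega> \<subseteq> C \<or> curve_chars \<omega> \<subseteq> D"
  proof (rule ccontr)
    assume "\<not> ?thesis"
    then have not: "\<not> curve_chars \<omega> \<subseteq> C" "\<not> curve_chars \<omega> \<subseteq> D" by auto
    obtain f \<psi>1 where f: "polyfun UNIV f" "\<psi>1 \<in> curve_chars \<omega>" "f (zc \<psi>1) (yc \<psi>1) \<noteq> 0"
        "\<forall>\<psi>\<in>curve_chars \<omega>. f (zc \<psi>) (yc \<psi>) \<noteq> 0 \<longrightarrow> \<psi> \<notin> C"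
      using witness[OF closed(1) not(1)] by blast
    obtain g \<psi>2 where g: "polyfun UNIV g" "\<psi>2 \<in> curve_chars \<omega>" "g (zc \<psi>2) (yc \<psi>2) \<noteq> 0"
        "\<forall>\<psi>\<in>curve_chars \<omega>. g (zc \<psi>) (yc \<psi>) \<noteq> 0 \<longrightarrow> \<psi> \<notin> D"
      using witness[OF closed(2) not(2)] by blast
    have "on_V (zc \<psi>1) (yc \<psi>1)" "on_V (zc \<psi>2) (yc \<psi>2)"
      using f(2) g(2) by (auto simp: curve_chars_iff)
    then obtain z y where zy: "on_V z y" "f z y \<noteq> 0" "g z y \<noteq> 0"
      using polyfun_nonzero_product[OF f(1) g(1)] f(3) g(3) by metis
    obtain \<psi> where "\<psi> \<in> curve_chars \<omega>" "zc \<psi> = z" "yc \<psi> = y"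
      using curve_chars_surj[OF zy(1) \<omega>] .
    with zy f(4) g(4) sub show False by blast
  qed
qed

section \<open>Hyperbolic curves\<close>

text \<open>A closed condition valid on the nonempty open part \<open>f \<noteq> 0\<close> of an
  irreducible set is valid on the whole set.\<close>

lemma irreducible_split:
  assumes X: "zariski_irreducible X" "X \<subseteq> XN"
    and f: "(\<lambda>\<psi>\<in>XN. f \<psi>) \<in> gen_algebra XN UNIV (Ifun XN ` carrier piN)"
    and C: "zariski_closed C" and or: "\<And>\<psi>. \<psi> \<in> X \<Longrightarrow> f \<psi> = 0 \<or> \<psi> \<in> C"
    and ne: "\<psi>0 \<in> X" "f \<psi>0 \<noteq> 0"
  shows "X \<subseteq> C"
proof -
  have "X \<subseteq> {\<psi> \<in> XN. f \<psi> = 0} \<union> C" using or X(2) by auto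
  with X(1) closed_zero_set[OF f] C have "X \<subseteq> {\<psi> \<in> XN. f \<psi> = 0} \<or> X \<subseteq> C"
    unfolding zariski_irreducible_def by blast
  with ne show ?thesis by blast
qed

theorem hyperbolic_curve_eq:
  assumes "hyperbolic_curve X"
  obtains \<omega> where "\<omega> * \<omega> = -1" "X = curve_chars \<omega>"
proof -
  obtain \<rho> where \<rho>: "discrete_faithful \<rho>" "character \<rho> \<in> X" and comp: "irreducible_component X"
    using assms by (auto simp: hyperbolic_curve_def)
  have closed: "zariski_closed X" and irr: "zariski_irreducible X"
    and max: "\<And>Z. zariski_closed Z \<Longrightarrow> zariski_irreducible Z \<Longrightarrow> X \<subseteq> Z \<Longrightarrow> Z = X"
    using comp by (auto simp: irreducible_component_def)
  have XN: "X \<subseteq> XN" using closed by (auto simp: zariski_closed_def)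
  define \<psi>0 where "\<psi>0 = character \<rho>"
  have \<psi>0: "\<psi>0 \<in> X" using \<rho>(2) by (simp add: \<psi>0_def)
  obtain A0 B0 T0 where 0: "is_rep A0 B0 T0" "\<And>w. character \<rho> (word_class relN w) = tr2 (weval A0 B0 T0 w)"
    "\<And>u v. weval A0 B0 T0 u = weval A0 B0 T0 v \<Longrightarrow> word_eq relN u v"
    using discrete_faithful_E[OF \<rho>(1)] by blast
  have "yc \<psi>0 \<noteq> 0" "(zc \<psi>0)\<^sup>2 - 4 \<noteq> 0"
    using faithful_nondegenerate[OF 0(1,3)] by (simp_all add: \<psi>0_def coord_def 0(2))
  \<comment> \<open>\<open>b\<close> vanishes on the degenerate characters but not at the faithful
    one, so \<open>irreducible_split\<close> allows them to be ignored.\<close>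
  define b where "b \<psi> = yc \<psi> * ((zc \<psi>)\<^sup>2 - 4)" for \<psi>
  have b: "(\<lambda>\<psi>\<in>XN. b \<psi>) \<in> gen_algebra XN UNIV (Ifun XN ` carrier piN)"
    unfolding b_def by (intro regular_intros)
  have b0: "b \<psi>0 \<noteq> 0" using \<open>yc \<psi>0 \<noteq> 0\<close> \<open>(zc \<psi>0)\<^sup>2 - 4 \<noteq> 0\<close> by (simp add: b_def)
  \<comment> \<open>For \<open>\<omega> = \<plusminus>\<i>\<close> these are the two factors of
    \<open>t^2 + z^4 / 4\<close>.\<close>
  define h where "h \<omega> \<psi> = coord wt \<psi> - \<omega> / 2 * (zc \<psi>)\<^sup>2" for \<omega> \<psi>
  have h: "(\<lambda>\<psi>\<in>XN. h \<omega> \<psi>) \<in> gen_algebra XN UNIV (Ifun XN ` carrier piN)" for \<omega>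
    unfolding h_def by (intro regular_intros)
  have split: "b \<psi> = 0 \<or> h \<i> \<psi> = 0 \<or> h (- \<i>) \<psi> = 0" if "\<psi> \<in> X" for \<psi>
  proof (cases "b \<psi> = 0")
    case False
    obtain A B T where AB: "is_rep A B T" "\<And>w. coord w \<psi> = tr2 (weval A B T w)"
      using XN_E[of \<psi>] \<open>\<psi> \<in> X\<close> XN unfolding coord_def by blast
    have "(coord wt \<psi>)\<^sup>2 = - (zc \<psi> ^ 4 / 4)"
      using rep_tau_traces(4)[OF AB(1)] False by (simp add: b_def AB(2))
    moreover have "h \<i> \<psi> * h (- \<i>) \<psi> = (coord wt \<psi>)\<^sup>2 + zc \<psi> ^ 4 / 4"
      by (simp add: h_def algebra_simps power2_eq_square power4_eq_xxxx)
    ultimately have "h \<i> \<psi> * h (- \<i>) \<psi> = 0" by simp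
    then show ?thesis by simp
  qed simp
  have "X \<subseteq> {\<psi> \<in> XN. h \<i> \<psi> * h (- \<i>) \<psi> = 0}"
  proof (rule irreducible_split[OF irr XN b _ _ \<psi>0 b0])
    show "zariski_closed {\<psi> \<in> XN. h \<i> \<psi> * h (- \<i>) \<psi> = 0}"
      by (intro closed_zero_set gen_algebra_mult h)
  qed (use split XN in auto)
  \<comment> \<open>A second use of irreducibility selects the sign of \<omega>.\<close>
  then have "X \<subseteq> {\<psi> \<in> XN. h \<i> \<psi> = 0} \<union> {\<psi> \<in> XN. h (- \<i>) \<psi> = 0}" by auto
  then have "X \<subseteq> {\<psi> \<in> XN. h \<i> \<psi> = 0} \<or> X \<subseteq> {\<psi> \<in> XN. h (- \<i>) \<psi> = 0}"
    using irr closed_zero_set[OF h] unfolding zariski_irreducible_def by blast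
  then have "\<exists>\<omega>. \<omega> * \<omega> = -1 \<and> X \<subseteq> {\<psi> \<in> XN. h \<omega> \<psi> = 0}"
    by (auto intro: exI[of _ "\<i>"] exI[of _ "- \<i>"])
  then obtain \<omega> where \<omega>: "\<omega> * \<omega> = -1" "X \<subseteq> {\<psi> \<in> XN. h \<omega> \<psi> = 0}" by blast
  have "X \<subseteq> curve_chars \<omega>"
  proof (rule irreducible_split[OF irr XN b closed_curve_chars _ \<psi>0 b0])
    have "\<psi> \<in> curve_chars \<omega>" if \<psi>: "\<psi> \<in> X" "b \<psi> \<noteq> 0" for \<psi>
    proof -
    obtain A B T where AB: "is_rep A B T" "\<And>w. coord w \<psi> = tr2 (weval A B T w)"
      using XN_E[of \<psi>] \<psi> XN unfolding coord_def by blast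
    have "h \<omega> \<psi> = 0" using \<omega>(2) \<psi> by auto
    then have "tr2 T = \<omega> * (tr2 (A * B))\<^sup>2 / 2" by (simp add: h_def AB(2))
    moreover have "tr2 B \<noteq> 0" "(tr2 (A * B))\<^sup>2 \<noteq> 4" using \<psi>(2) by (auto simp: b_def AB(2))
    ultimately have "on_curve \<omega> A B T" using on_curveI[OF AB(1)] by blast
    with AB(2) \<psi>(1) XN show ?thesis by (auto simp: curve_chars_def)
    qed
    then show "b \<psi> = 0 \<or> \<psi> \<in> curve_chars \<omega>" if "\<psi> \<in> X" for \<psi>
      using that by blast
  qed
  \<comment> \<open>The inclusion is an equality because a component is maximal among irreducible
    closed sets.\<close>
  with max[OF closed_curve_chars irreducible_curve_chars[OF \<omega>(1)]] \<omega>(1) show thesis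
    using that by blast
qed

section \<open>Spanning over the ring of polynomials in the longitude trace\<close>

definition lambda_trace :: "complex \<Rightarrow> complex \<Rightarrow> complex" where "lambda_trace z y = y\<^sup>2 - 4 + z\<^sup>2 / 2"

definition lambda_word :: "gen word" where "lambda_word = wa @ wb @ winv wa @ winv wb"

lemma coord_lambda:
  assumes "\<psi> \<in> curve_chars \<omega>"
  shows "coord lambda_word \<psi> = lambda_trace (zc \<psi>) (yc \<psi>)"
proof -
  obtain A B T where AB: "on_curve \<omega> A B T" "\<And>w. coord w \<psi> = tr2 (weval A B T w)"
    using assms by (auto simp: curve_chars_def)
  have d: "det2 A = 1" "det2 B = 1" using on_curve_det[OF AB(1)] by auto
  define y z where "y = yc \<psi>" and "z = zc \<psi>"
  have V: "z\<^sup>2 * (y\<^sup>2 - 2) = 8" and x: "tr2 A = y * z / 2"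
    using assms AB(2)[of wa] by (auto simp: curve_chars_iff on_V_def y_def z_def)
  have "coord lambda_word \<psi> = (y * z / 2)\<^sup>2 + y\<^sup>2 + z\<^sup>2 - y * z / 2 * y * z - 2"
    using tr2_commutator[OF d] by (simp add: AB(2) lambda_word_def weval_winv mult.assoc x y_def z_def)
  \<comment> \<open>The terms with \<open>y^2 * z^2\<close> are collected into the left side of the
    curve equation, which is then replaced by 8.\<close>
  also have "\<dots> = y\<^sup>2 + z\<^sup>2 - 2 - z\<^sup>2 * (y\<^sup>2 - 2) / 4 - z\<^sup>2 / 2"
    by (simp add: field_simps power2_eq_square)
  also have "\<dots> = lambda_trace z y" by (simp add: V lambda_trace_def)
  finally show ?thesis by (simp add: y_def z_def)
qed

text \<open>The two rules that lower the degree in \<open>z\<close> below 4 and the degree in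
  \<open>y\<close> below 2, with coefficients polynomial in \<open>l\<close>.\<close>

lemma on_V_reduce:
  assumes "on_V z y"
  shows "z ^ 4 = 2 * (lambda_trace z y + 2) * z\<^sup>2 - 16" and "y\<^sup>2 = lambda_trace z y + 4 - z\<^sup>2 / 2"
proof -
  have "2 * (lambda_trace z y + 2) * z\<^sup>2 - 16 = 2 * (z\<^sup>2 * (y\<^sup>2 - 2)) + z ^ 4 - 16"
    by (simp add: lambda_trace_def algebra_simps power2_eq_square power4_eq_xxxx)
  then show "z ^ 4 = 2 * (lambda_trace z y + 2) * z\<^sup>2 - 16"
    using assms by (simp add: on_V_def)
qed (simp add: lambda_trace_def)

text \<open>Rational polynomials are taken inside \<open>complex poly\<close>, so that they can be
  evaluated at complex traces directly.\<close>

definition rat_poly :: "complex poly \<Rightarrow> bool" where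
  "rat_poly p \<longleftrightarrow> (\<forall>n. Polynomial.coeff p n \<in> \<rat>)"

lemma rat_poly_add: "rat_poly p \<Longrightarrow> rat_poly q \<Longrightarrow> rat_poly (p + q)"
  by (simp add: rat_poly_def)

lemma rat_poly_mult: "rat_poly p \<Longrightarrow> rat_poly q \<Longrightarrow> rat_poly (p * q)"
  by (simp add: rat_poly_def coeff_mult Rats_sum)

lemma rat_poly_pCons: "c \<in> \<rat> \<Longrightarrow> rat_poly p \<Longrightarrow> rat_poly (pCons c p)"
  by (simp add: rat_poly_def coeff_pCons split: nat.split)

lemma rat_poly_0: "rat_poly 0"
  by (simp add: rat_poly_def)

lemma rat_poly_real: 
  assumes "rat_poly p"
  shows "poly p (of_real x) \<in> \<real>"
  using assms
proof (induction p)
  case (pCons c p)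
  have "c \<in> \<rat>" using pCons.prems by (auto simp: rat_poly_def coeff_pCons split: nat.splits dest: spec[of _ 0])
  then have "c \<in> \<real>" by (elim Rats_cases') simp
  moreover have "rat_poly p"
    unfolding rat_poly_def
  proof
    show "Polynomial.coeff p n \<in> \<rat>" for n
      using pCons.prems unfolding rat_poly_def by (metis coeff_pCons_Suc)
  qed
  ultimately show ?case using pCons.IH by auto
qed simp

definition exponents :: "(nat \<times> nat \<times> nat) set" where "exponents = {..<2} \<times> {..<4} \<times> {..<2}"

text \<open>On the curve the trace of \<tau> is \<open>\<omega> * z^2 / 2\<close>, so these are the
  monomials \<open>t^k * z^i * y^j\<close>, and \<open>exponents\<close> lists the sixteen of the
  proposed basis.\<close>

definition curve_monom :: "complex \<Rightarrow> nat \<times> nat \<times> nat \<Rightarrow> complex \<Rightarrow> complex \<Rightarrow> complex" where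
  "curve_monom \<omega> = (\<lambda>(k, i, j) z y. (\<omega> * z\<^sup>2 / 2) ^ k * z ^ i * y ^ j)"

definition in_span :: "complex \<Rightarrow> (complex \<Rightarrow> complex \<Rightarrow> complex) \<Rightarrow> bool" where
  "in_span \<omega> g \<longleftrightarrow> (\<exists>p. (\<forall>i\<in>exponents. rat_poly (p i)) \<and>
     (\<forall>z y. on_V z y \<longrightarrow> g z y = (\<Sum>i\<in>exponents. poly (p i) (lambda_trace z y) * curve_monom \<omega> i z y)))"

lemma finite_exponents [simp]: "finite exponents"
  by (simp add: exponents_def)

lemma in_span_cong:
  assumes "in_span \<omega> g" "\<And>z y. on_V z y \<Longrightarrow> h z y = g z y"
  shows "in_span \<omega> h"
  using assms unfolding in_span_def by metis

lemma in_span_monom: "i \<in> exponents \<Longrightarrow> in_span \<omega> (curve_monom \<omega> i)"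
  unfolding in_span_def
  by (rule exI[of _ "\<lambda>j. if j = i then [:1:] else 0"])
    (auto simp: rat_poly_0 rat_poly_pCons if_distrib[of "\<lambda>p. poly p _"] if_distrib[of "\<lambda>u. u * _"]
      cong: if_cong)

lemma in_span_add:
  assumes "in_span \<omega> g" "in_span \<omega> h"
  shows "in_span \<omega> (\<lambda>z y. g z y + h z y)"
proof -
  obtain p q where "\<forall>i\<in>exponents. rat_poly (p i)" "\<forall>i\<in>exponents. rat_poly (q i)"
    "\<And>z y. on_V z y \<Longrightarrow> g z y = (\<Sum>i\<in>exponents. poly (p i) (lambda_trace z y) * curve_monom \<omega> i z y)"
    "\<And>z y. on_V z y \<Longrightarrow> h z y = (\<Sum>i\<in>exponents. poly (q i) (lambda_trace z y) * curve_monom \<omega> i z y)"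
    using assms unfolding in_span_def by blast
  then show ?thesis
    unfolding in_span_def
    by (intro exI[of _ "\<lambda>i. p i + q i"]) (auto simp: rat_poly_add distrib_right sum.distrib)
qed

lemma in_span_scale:
  assumes "in_span \<omega> g" "rat_poly q"
  shows "in_span \<omega> (\<lambda>z y. poly q (lambda_trace z y) * g z y)"
proof -
  obtain p where "\<forall>i\<in>exponents. rat_poly (p i)"
    "\<And>z y. on_V z y \<Longrightarrow> g z y = (\<Sum>i\<in>exponents. poly (p i) (lambda_trace z y) * curve_monom \<omega> i z y)"
    using assms unfolding in_span_def by blast
  with assms(2) show ?thesis
    unfolding in_span_def
    by (intro exI[of _ "\<lambda>i. q * p i"]) (auto simp: rat_poly_mult sum_distrib_left mult.assoc)
qed

lemma in_span_zero: "in_span \<omega> (\<lambda>z y. 0)"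
  unfolding in_span_def by (rule exI[of _ "\<lambda>i. 0"]) (auto simp: rat_poly_0)

lemma in_span_sum:
  assumes "finite S" "\<And>s. s \<in> S \<Longrightarrow> in_span \<omega> (f s)"
  shows "in_span \<omega> (\<lambda>z y. \<Sum>s\<in>S. f s z y)"
  using assms by (induction S) (auto intro: in_span_zero in_span_add)

text \<open>Multiplication by \<open>m\<close> is linear over \<rat>[l], so stability of the span is
  tested on the sixteen monomials.\<close>

lemma in_span_mult:
  assumes "\<And>i. i \<in> exponents \<Longrightarrow> in_span \<omega> (\<lambda>z y. m z y * curve_monom \<omega> i z y)" and "in_span \<omega> g"
  shows "in_span \<omega> (\<lambda>z y. m z y * g z y)"
proof -
  obtain p where p: "\<forall>i\<in>exponents. rat_poly (p i)"
    "\<And>z y. on_V z y \<Longrightarrow> g z y = (\<Sum>i\<in>exponents. poly (p i) (lambda_trace z y) * curve_monom \<omega> i z y)"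
    using assms unfolding in_span_def by blast
  have "in_span \<omega> (\<lambda>z y. \<Sum>i\<in>exponents. poly (p i) (lambda_trace z y) * (m z y * curve_monom \<omega> i z y))"
    using assms(1) p(1) by (intro in_span_sum in_span_scale) auto
  then show ?thesis
    by (rule in_span_cong) (simp add: p(2) sum_distrib_left mult.left_commute)
qed

lemma in_span_monom_all:
  assumes "k < 2" "j < 2"
  shows "in_span \<omega> (curve_monom \<omega> (k, i, j))"
proof (induction i rule: less_induct)
  case (less i)
  show ?case
  proof (cases "i < 4")
    case True
    with assms show ?thesis by (intro in_span_monom) (simp add: exponents_def)
  next
    case False
    \<comment> \<open>The recursion
      \<open>z^i = 2 * (l + 2) * z^(i-2) - 16 * z^(i-4)\<close>.\<close>
    have "in_span \<omega> (\<lambda>z y. poly [:4, 2:] (lambda_trace z y) * curve_monom \<omega> (k, i - 2, j) z y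
        + poly [:- 16:] (lambda_trace z y) * curve_monom \<omega> (k, i - 4, j) z y)"
      using False by (intro in_span_add in_span_scale less.IH rat_poly_pCons rat_poly_0) auto
    then show ?thesis
    proof (rule in_span_cong)
      fix z y assume V: "on_V z y"
      obtain n where i: "i = n + 4" using False by (metis add.commute le_Suc_ex not_less)
      have "z ^ i = z ^ n * z ^ 4" by (simp add: i power_add)
      also have "\<dots> = poly [:4, 2:] (lambda_trace z y) * z ^ (i - 2) + poly [:- 16:] (lambda_trace z y) * z ^ (i - 4)"
        unfolding on_V_reduce(1)[OF V] by (simp add: i algebra_simps power_add power2_eq_square)
      finally have eq: "z ^ i = poly [:4, 2:] (lambda_trace z y) * z ^ (i - 2) + poly [:- 16:] (lambda_trace z y) * z ^ (i - 4)" .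
      show "curve_monom \<omega> (k, i, j) z y = poly [:4, 2:] (lambda_trace z y) * curve_monom \<omega> (k, i - 2, j) z y
        + poly [:- 16:] (lambda_trace z y) * curve_monom \<omega> (k, i - 4, j) z y"
        by (simp only: curve_monom_def prod.case eq) (simp add: algebra_simps)
    qed
  qed
qed

lemma in_span_fst: "in_span \<omega> g \<Longrightarrow> in_span \<omega> (\<lambda>z y. z * g z y)"
proof (rule in_span_mult)
  fix i assume "i \<in> exponents"
  then obtain k n j where i: "i = (k, n, j)" "k < 2" "j < 2" by (auto simp: exponents_def)
  show "in_span \<omega> (\<lambda>z y. z * curve_monom \<omega> i z y)"
    by (rule in_span_cong[OF in_span_monom_all[OF i(2,3), of _ "Suc n"]]) (simp add: curve_monom_def i(1))
qed

lemma in_span_const: "in_span \<omega> g \<Longrightarrow> c \<in> \<rat> \<Longrightarrow> in_span \<omega> (\<lambda>z y. c * g z y)"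
  using in_span_scale[of \<omega> g "[:c:]"] by (simp add: rat_poly_pCons rat_poly_0)

lemma in_span_snd: "in_span \<omega> g \<Longrightarrow> in_span \<omega> (\<lambda>z y. y * g z y)"
proof (rule in_span_mult)
  fix i assume "i \<in> exponents"
  then obtain k n j where i: "i = (k, n, j)" "k < 2" "j < 2" by (auto simp: exponents_def)
  show "in_span \<omega> (\<lambda>z y. y * curve_monom \<omega> i z y)"
  proof (cases j)
    case 0
    show ?thesis
      by (rule in_span_cong[OF in_span_monom_all[OF i(2), of 1 _ n]]) (simp_all add: curve_monom_def i(1) 0)
  next
    case (Suc j')
    then have j: "j = 1" using i(3) by simp
    \<comment> \<open>From \<open>y^2 = l + 4 - z^2 / 2\<close>; the exponent of \<open>z\<close>
      may grow beyond 3, which \<open>in_span_monom_all\<close> permits.\<close>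
    have "in_span \<omega> (\<lambda>z y. poly [:4, 1:] (lambda_trace z y) * curve_monom \<omega> (k, n, 0) z y
        + - 1 / 2 * curve_monom \<omega> (k, n + 2, 0) z y)"
      using i(2)
      by (intro in_span_add in_span_scale in_span_const in_span_monom_all rat_poly_pCons rat_poly_0) auto
    then show ?thesis
    proof (rule in_span_cong)
      fix z y assume V: "on_V z y"
      have "y * curve_monom \<omega> i z y = y\<^sup>2 * curve_monom \<omega> (k, n, 0) z y"
        by (simp add: curve_monom_def i(1) j power2_eq_square)
      also have "\<dots> = poly [:4, 1:] (lambda_trace z y) * curve_monom \<omega> (k, n, 0) z y
        + - 1 / 2 * curve_monom \<omega> (k, n + 2, 0) z y"
        unfolding on_V_reduce(2)[OF V] by (simp add: curve_monom_def algebra_simps power2_eq_square)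
      finally show "y * curve_monom \<omega> i z y = \<dots>" .
    qed
  qed
qed

lemma in_span_tau:
  assumes "\<omega> * \<omega> = -1"
  shows "in_span \<omega> g \<Longrightarrow> in_span \<omega> (\<lambda>z y. \<omega> * z\<^sup>2 / 2 * g z y)"
proof (rule in_span_mult)
  fix i assume "i \<in> exponents"
  then obtain k n j where i: "i = (k, n, j)" "k < 2" "j < 2" by (auto simp: exponents_def)
  show "in_span \<omega> (\<lambda>z y. \<omega> * z\<^sup>2 / 2 * curve_monom \<omega> i z y)"
  proof (cases k)
    case 0
    show ?thesis
      by (rule in_span_cong[OF in_span_monom_all[OF _ i(3), of 1 _ n]]) (simp_all add: curve_monom_def i(1) 0)
  next
    case (Suc k')
    then have k: "k = 1" using i(2) by simp
    \<comment> \<open>From \<open>t^2 = - (z^4) / 4\<close>.\<close>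
    have "in_span \<omega> (\<lambda>z y. - 1 / 4 * curve_monom \<omega> (0, n + 4, j) z y)"
      using i(3) by (intro in_span_const in_span_monom_all) auto
    then show ?thesis
    proof (rule in_span_cong)
      fix z y
      have "\<omega> * z\<^sup>2 / 2 * curve_monom \<omega> i z y = (\<omega> * \<omega>) / 4 * (z ^ 4 * z ^ n * y ^ j)"
        by (simp add: curve_monom_def i(1) k power2_eq_square power4_eq_xxxx)
      then show "\<omega> * z\<^sup>2 / 2 * curve_monom \<omega> i z y = - 1 / 4 * curve_monom \<omega> (0, n + 4, j) z y"
        by (simp add: assms curve_monom_def power_add mult.commute)
    qed
  qed
qed

text \<open>Uses \<open>2 / z\<^sup>2 = (2 * (l + 2) - z\<^sup>2) / 8\<close>.\<close>

lemma in_span_omega: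
  assumes "\<omega> * \<omega> = -1" "in_span \<omega> g"
  shows "in_span \<omega> (\<lambda>z y. \<omega> * g z y)"
proof (rule in_span_cong)
  show "in_span \<omega> (\<lambda>z y. \<omega> * z\<^sup>2 / 2 * (poly [:1/2, 1/4:] (lambda_trace z y) * g z y + - 1 / 8 * (z * (z * g z y))))"
    by (intro in_span_tau in_span_add in_span_scale in_span_const in_span_fst rat_poly_pCons
        rat_poly_0 assms) auto
  fix z y assume V: "on_V z y"
  have "z\<^sup>2 / 2 * (poly [:1/2, 1/4:] (lambda_trace z y) + - 1 / 8 * z\<^sup>2)
      = (2 * (lambda_trace z y + 2) * z\<^sup>2 - z ^ 4) / 16"
    by (simp add: field_simps power2_eq_square power4_eq_xxxx)
  also have "\<dots> = 1" unfolding on_V_reduce(1)[OF V] by simp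
  finally have "z\<^sup>2 / 2 * (poly [:1/2, 1/4:] (lambda_trace z y) + - 1 / 8 * z\<^sup>2) * (\<omega> * g z y) = \<omega> * g z y"
    by simp
  then show "\<omega> * g z y = \<omega> * z\<^sup>2 / 2 *
      (poly [:1/2, 1/4:] (lambda_trace z y) * g z y + - 1 / 8 * (z * (z * g z y)))"
    by (simp add: algebra_simps power2_eq_square)
qed

lemma polyfun_in_span:
  assumes \<omega>: "\<omega> * \<omega> = -1" and "polyfun (insert \<omega> \<rat>) g"
  shows "in_span \<omega> g"
proof -
  \<comment> \<open>Stability of the span under multiplication by \<open>g\<close> is what passes
    through the product case of the induction; the claim is its instance
    \<open>h = 1\<close>.\<close>
  have "in_span \<omega> (\<lambda>z y. g z y * h z y)" if "in_span \<omega> h" for h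
    using assms(2) that
  proof (induction arbitrary: h)
    case (const c) then show ?case using in_span_const in_span_omega[OF \<omega>] by auto
  next
    case fst then show ?case by (rule in_span_fst)
  next
    case snd then show ?case by (rule in_span_snd)
  next
    case (add f g) then show ?case by (simp add: distrib_right in_span_add)
  next
    case (mult f g) then show ?case by (simp add: mult.assoc)
  qed
  from this[OF in_span_monom_all[of 0 0 \<omega> 0]] show ?thesis
    by (simp add: curve_monom_def)
qed

section \<open>Linear independence\<close>

lemma sum_exponents:
  "(\<Sum>i\<in>exponents. f i) = (\<Sum>k<2. \<Sum>i<4. \<Sum>j<2. f (k, i, j))"
  by (simp add: exponents_def sum.cartesian_product)

text \<open>The four sign choices isolate the parts of each parity in \<open>z\<close> and
  \<open>y\<close>.\<close>

lemma cubic_sign_separation: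
  fixes c0 c1 c2 c3 d0 d1 d2 d3 z y :: complex
  assumes "z \<noteq> 0" "y \<noteq> 0"
    and "\<And>z' y'. z' \<in> {z, -z} \<Longrightarrow> y' \<in> {y, -y} \<Longrightarrow>
      c0 + c1 * z' + c2 * z'^2 + c3 * z'^3 + (d0 + d1 * z' + d2 * z'^2 + d3 * z'^3) * y' = 0"
  shows "c0 + c2 * z\<^sup>2 = 0" "c1 + c3 * z\<^sup>2 = 0" "d0 + d2 * z\<^sup>2 = 0" "d1 + d3 * z\<^sup>2 = 0"
proof -
  define C0 C1 D0 D1 where "C0 = c0 + c2 * z\<^sup>2" and "C1 = (c1 + c3 * z\<^sup>2) * z"
    and "D0 = (d0 + d2 * z\<^sup>2) * y" and "D1 = (d1 + d3 * z\<^sup>2) * z * y"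
  note defs = C0_def C1_def D0_def D1_def algebra_simps power2_eq_square power3_eq_cube
  have 1: "C0 + C1 + D0 + D1 = 0"
    using assms(3)[of z y] by (simp add: defs)
  have 2: "C0 - C1 + D0 - D1 = 0"
    using assms(3)[of "-z" y] by (simp add: defs)
  have 3: "C0 + C1 - D0 - D1 = 0"
    using assms(3)[of z "-y"] by (simp add: defs)
  have 4: "C0 - C1 - D0 + D1 = 0"
    using assms(3)[of "-z" "-y"] by (simp add: defs)
  \<comment> \<open>Inverts the 4 by 4 matrix of signs, which is orthogonal up to the factor
    4.\<close>
  have "4 * C0 = (C0 + C1 + D0 + D1) + (C0 - C1 + D0 - D1) + (C0 + C1 - D0 - D1) + (C0 - C1 - D0 + D1)"
    "4 * C1 = (C0 + C1 + D0 + D1) - (C0 - C1 + D0 - D1) + (C0 + C1 - D0 - D1) - (C0 - C1 - D0 + D1)"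
    "4 * D0 = (C0 + C1 + D0 + D1) + (C0 - C1 + D0 - D1) - (C0 + C1 - D0 - D1) - (C0 - C1 - D0 + D1)"
    "4 * D1 = (C0 + C1 + D0 + D1) - (C0 - C1 + D0 - D1) - (C0 + C1 - D0 - D1) + (C0 - C1 - D0 + D1)"
    by (simp_all add: algebra_simps)
  then have "C0 = 0" "C1 = 0" "D0 = 0" "D1 = 0"
    unfolding 1 2 3 4 by simp_all
  with assms(1,2) show "c0 + c2 * z\<^sup>2 = 0" "c1 + c3 * z\<^sup>2 = 0" "d0 + d2 * z\<^sup>2 = 0" "d1 + d3 * z\<^sup>2 = 0"
    by (simp_all add: C0_def C1_def D0_def D1_def)
qed

text \<open>The sign of \<open>\<omega> = \<plusminus>\<i>\<close> is left open; squaring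
  \<open>a = - (\<omega> * b)\<close> gives \<open>a^2 + b^2 = 0\<close> over the reals.\<close>

lemma real_imag_separation:
  fixes \<omega> a b :: complex
  assumes "\<omega> * \<omega> = -1" "a \<in> \<real>" "b \<in> \<real>" "a + \<omega> * b = 0"
  shows "a = 0" "b = 0"
proof -
  obtain r s where rs: "a = of_real r" "b = of_real s"
    using assms(2,3) by (auto elim!: Reals_cases)
  have "a = - (\<omega> * b)" using assms(4) by (simp add: eq_neg_iff_add_eq_0)
  then have "a * a = (\<omega> * \<omega>) * (b * b)" by (simp add: algebra_simps)
  then have "of_real (r * r + s * s) = (0 :: complex)" using assms(1) by (simp add: rs)
  then have "r * r + s * s = 0" by (simp only: of_real_eq_0_iff)
  then show "a = 0" "b = 0" by (auto simp: rs sum_squares_eq_zero_iff)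
qed

text \<open>Here \<open>u\<close> is \<open>z^2\<close> and \<open>v\<close> is \<open>l\<close>;
  the hypothesis \<open>v\<close> is the quartic relation for \<open>z\<close> divided by
  \<open>z^2\<close>. All four sign choices share the same \<open>l\<close>.\<close>

lemma on_V_real:
  fixes u v :: real
  assumes u: "u > 0" and v: "u + 16 / u = 2 * (v + 2)"
  obtains z y where "z \<in> \<real>" "y \<in> \<real>" "z \<noteq> 0" "y \<noteq> 0" "z\<^sup>2 = of_real u"
    "\<And>z' y'. z' \<in> {z, -z} \<Longrightarrow> y' \<in> {y, -y} \<Longrightarrow> on_V z' y' \<and> lambda_trace z' y' = of_real v"
proof -
  define z y where "z = complex_of_real (sqrt u)" and "y = complex_of_real (sqrt (2 + 8 / u))"
  have p: "2 + 8 / u > 0" using u by (simp add: add_pos_pos)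
  have z2: "z\<^sup>2 = of_real u" and y2: "y\<^sup>2 = of_real (2 + 8 / u)"
    using u p unfolding z_def y_def of_real_power[symmetric] by simp_all
  have "on_V z y" using u by (simp add: on_V_def z2 y2)
  moreover have "lambda_trace z y = of_real v"
  proof -
    have "lambda_trace z y = of_real (2 + 8 / u - 4 + u / 2)"
      by (simp add: lambda_trace_def z2 y2)
    also have "2 + 8 / u - 4 + u / 2 = v" using v by (simp add: field_simps)
    finally show ?thesis .
  qed
  moreover have "z \<in> \<real>" "y \<in> \<real>" "z \<noteq> 0" "y \<noteq> 0" using u p by (simp_all add: z_def y_def)
  ultimately show thesis
    using z2 by (intro that[of z y]) (auto simp: on_V_def lambda_trace_def)
qed

lemma rat_poly_separation:
  assumes \<omega>: "\<omega> * \<omega> = -1" and rat: "\<And>i. i \<in> exponents \<Longrightarrow> rat_poly (p i)"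
    and zero: "\<And>z y. on_V z y \<Longrightarrow> (\<Sum>i\<in>exponents. poly (p i) (lambda_trace z y) * curve_monom \<omega> i z y) = 0"
    and u: "u > 0" and v: "u + 16 / u = 2 * (v + 2)" and "k < 2" "i < 2" "j < 2"
  shows "poly (p (k, i, j)) (of_real v) + poly (p (k, i + 2, j)) (of_real v) * of_real u = 0"
proof -
  obtain z y where zy: "z \<in> \<real>" "y \<in> \<real>" "z \<noteq> 0" "y \<noteq> 0" "z\<^sup>2 = of_real u"
    "\<And>z' y'. z' \<in> {z, -z} \<Longrightarrow> y' \<in> {y, -y} \<Longrightarrow> on_V z' y' \<and> lambda_trace z' y' = of_real v"
    using on_V_real[OF u v] by metis
  define c where "c k i j = poly (p (k, i, j)) (of_real v)" for k i j
  \<comment> \<open>\<open>E k\<close> collects the terms with \<open>t^k\<close>, without the power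
    of \<open>t\<close>.\<close>
  define E where "E k z' y' = (\<Sum>i<4. \<Sum>j<2. c k i j * z' ^ i * y' ^ j)" for k z' y'
  have c: "c k i j \<in> \<real>" if "k < 2" "i < 4" "j < 2" for k i j
    unfolding c_def using that by (intro rat_poly_real rat) (simp add: exponents_def)
  have E0: "E 0 z' y' = 0 \<and> E 1 z' y' = 0" if s: "z' \<in> {z, -z}" "y' \<in> {y, -y}" for z' y'
  proof -
    have "z' \<in> \<real>" "y' \<in> \<real>" using s zy(1,2) by auto
    then have "E k z' y' \<in> \<real>" if "k < 2" for k
      unfolding E_def using that c by (intro sum_in_Reals Reals_mult Reals_power) auto
    then have R: "E 0 z' y' \<in> \<real>" "z'\<^sup>2 / 2 * E 1 z' y' \<in> \<real>"
      using \<open>z' \<in> \<real>\<close> by auto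
    \<comment> \<open>At a real point \<omega> is the only quantity that is not real, so both
      summands vanish separately.\<close>
    have "E 0 z' y' + \<omega> * (z'\<^sup>2 / 2 * E 1 z' y') = (\<Sum>i\<in>exponents. poly (p i) (lambda_trace z' y') * curve_monom \<omega> i z' y')"
      using zy(6)[OF s] by (simp add: sum_exponents curve_monom_def E_def c_def sum_distrib_left numeral_2_eq_2
          distrib_left add_divide_distrib sum.distrib mult.assoc mult.commute mult.left_commute)
    also have "\<dots> = 0" using zy(6)[OF s] zero by blast
    finally have "E 0 z' y' = 0" "z'\<^sup>2 / 2 * E 1 z' y' = 0"
      using real_imag_separation[OF \<omega> R] by auto
    then show ?thesis using s zy(3) by auto
  qed
  have E: "E k z' y' = 0" if "z' \<in> {z, -z}" "y' \<in> {y, -y}" for z' y'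
    using E0[OF that] \<open>k < 2\<close> by (cases k) (auto simp: less_Suc_eq numeral_2_eq_2)
  have expand: "E k z' y' = c k 0 0 + c k 1 0 * z' + c k 2 0 * z'^2 + c k 3 0 * z'^3
      + (c k 0 1 + c k 1 1 * z' + c k 2 1 * z'^2 + c k 3 1 * z'^3) * y'" for z' y'
    by (simp add: E_def eval_nat_numeral algebra_simps)
  have "c k 0 0 + c k 2 0 * z\<^sup>2 = 0" "c k 1 0 + c k 3 0 * z\<^sup>2 = 0"
    "c k 0 1 + c k 2 1 * z\<^sup>2 = 0" "c k 1 1 + c k 3 1 * z\<^sup>2 = 0"
    using cubic_sign_separation[OF zy(3,4), of "c k 0 0" "c k 1 0" "c k 2 0" "c k 3 0" "c k 0 1" "c k 1 1" "c k 2 1" "c k 3 1"]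
      E unfolding expand by auto
  moreover have "i = 0 \<or> i = 1" "j = 0 \<or> j = 1" using assms by auto
  ultimately have "c k i j + c k (i + 2) j * z\<^sup>2 = 0" by (auto simp: numeral_3_eq_3 numeral_2_eq_2)
  then show ?thesis by (simp add: c_def zy(5))
qed

lemma poly_zero_real:
  assumes "\<And>v. v > 2 \<Longrightarrow> poly p (complex_of_real v) = 0"
  shows "p = 0"
proof (rule ccontr)
  assume "p \<noteq> 0"
  then have "finite {x. poly p x = 0}" by (rule poly_roots_finite)
  moreover have "complex_of_real ` {2<..} \<subseteq> {x. poly p x = 0}" using assms by auto
  ultimately have "finite (complex_of_real ` {2<..})" by (rule finite_subset[rotated])
  then have "finite ({2<..} :: real set)" by (rule finite_imageD) (simp add: inj_on_def)
  then show False by (simp add: infinite_Ioi)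
qed

text \<open>For each real \<open>l = v > 2\<close> there are two positive values of
  \<open>z^2\<close>. A polynomial of degree at most one in \<open>z^2\<close> vanishing at both has
  zero coefficients, and a polynomial in \<open>l\<close> vanishing for all such \<open>v\<close> is
  zero.\<close>

lemma curve_monom_independent:
  assumes \<omega>: "\<omega> * \<omega> = -1" and rat: "\<And>i. i \<in> exponents \<Longrightarrow> rat_poly (p i)"
    and zero: "\<And>z y. on_V z y \<Longrightarrow> (\<Sum>i\<in>exponents. poly (p i) (lambda_trace z y) * curve_monom \<omega> i z y) = 0"
    and "m \<in> exponents"
  shows "p m = 0"
proof -
  have *: "poly (p (k, i, j)) (of_real v) = 0 \<and> poly (p (k, i + 2, j)) (of_real v) = 0"
    if "v > 2" "k < 2" "i < 2" "j < 2" for v k i j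
  proof -
    \<comment> \<open>The values of \<open>z^2\<close> are the roots of
      \<open>u^2 - 2 * (v + 2) * u + 16\<close>; \<open>v > 2\<close> makes them real and
      distinct.\<close>
    define r where "r = sqrt ((v + 2)\<^sup>2 - 16)"
    have "4 * 4 < (v + 2) * (v + 2)" using \<open>v > 2\<close> by (intro mult_strict_mono) auto
    then have pos: "(v + 2)\<^sup>2 - 16 > 0" by (simp add: power2_eq_square)
    then have r: "r\<^sup>2 = (v + 2)\<^sup>2 - 16" "r > 0" by (simp_all add: r_def)
    define u1 u2 where "u1 = v + 2 + r" and "u2 = v + 2 - r"
    have prod: "u1 * u2 = 16" using r(1) by (simp add: u1_def u2_def power2_eq_square algebra_simps)
    have u1: "u1 > 0" using r(2) \<open>v > 2\<close> by (simp add: u1_def)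
    have u2: "u2 > 0" using prod u1 by (metis zero_less_mult_pos zero_less_numeral)
    have "16 / u1 = u2" "16 / u2 = u1" using prod u1 u2 by (simp_all add: field_simps)
    then have v: "u1 + 16 / u1 = 2 * (v + 2)" "u2 + 16 / u2 = 2 * (v + 2)"
      by (simp_all add: u1_def u2_def)
    define a b where "a = poly (p (k, i, j)) (of_real v)" and "b = poly (p (k, i + 2, j)) (of_real v)"
    have 1: "a + b * of_real u1 = 0" and 2: "a + b * of_real u2 = 0"
      using rat_poly_separation[OF \<omega> rat zero u1 v(1) that(2-4)]
        rat_poly_separation[OF \<omega> rat zero u2 v(2) that(2-4)] by (simp_all add: a_def b_def)
    have "b * of_real (u1 - u2) = (a + b * of_real u1) - (a + b * of_real u2)"
      by (simp add: algebra_simps)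
    then have "b * of_real (u1 - u2) = 0" by (simp only: 1 2 diff_self)
    moreover have "u1 - u2 \<noteq> 0" using r(2) by (simp add: u1_def u2_def)
    ultimately have "b = 0" by (metis mult_eq_0_iff of_real_eq_0_iff)
    with 1 show ?thesis by (simp add: a_def b_def)
  qed
  obtain k i j where m: "m = (k, i, j)" "k < 2" "i < 4" "j < 2" using \<open>m \<in> exponents\<close> by (auto simp: exponents_def)
  show ?thesis
  proof (rule poly_zero_real)
    fix v :: real assume v: "v > 2"
    show "poly (p m) (of_real v) = 0"
    proof (cases "i < 2")
      case True then show ?thesis using *[OF v m(2) _ m(4), of i] m(1) by simp
    next
      case False
      then have i: "i - 2 < 2" "i - 2 + 2 = i" using m(3) by auto
      from *[OF v m(2) i(1) m(4)] show ?thesis by (simp only: m(1) i(2))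
    qed
  qed
qed

section \<open>The basis\<close>

lemma finsum_fun_ring:
  assumes "finite A"
  shows "(\<Oplus>\<^bsub>fun_ring X\<^esub>a\<in>A. (\<lambda>x\<in>X. f a x)) = (\<lambda>x\<in>X. \<Sum>a\<in>A. f a x)"
proof -
  interpret cring "fun_ring X" by (rule cring_fun_ring)
  have closed: "(\<lambda>x\<in>X. g x) \<in> carrier (fun_ring X)" for g
    by (simp only: fun_ring_simps restrict_extensional)
  show ?thesis
    using assms
  proof (induction A)
    case empty
    show ?case by (simp only: finsum_empty fun_ring_simps sum.empty)
  next
    case (insert a A)
    have "(\<Oplus>\<^bsub>fun_ring X\<^esub>a\<in>insert a A. (\<lambda>x\<in>X. f a x)) =
        (\<lambda>x\<in>X. f a x) \<oplus>\<^bsub>fun_ring X\<^esub> (\<Oplus>\<^bsub>fun_ring X\<^esub>a\<in>A. (\<lambda>x\<in>X. f a x))"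
      by (rule finsum_insert[OF insert.hyps]) (rule Pi_I, rule closed, rule closed)
    also have "\<dots> = (\<lambda>x\<in>X. f a x) \<oplus>\<^bsub>fun_ring X\<^esub> (\<lambda>x\<in>X. \<Sum>a\<in>A. f a x)"
      by (simp only: insert.IH)
    also have "\<dots> = (\<lambda>x\<in>X. \<Sum>a\<in>insert a A. f a x)"
      using insert.hyps by (auto simp: fun_ring_simps)
    finally show ?case .
  qed
qed

lemma gen_algebra_sum:
  assumes "finite A" "0 \<in> K" "\<And>a. a \<in> A \<Longrightarrow> (\<lambda>x\<in>X. f a x) \<in> gen_algebra X K S"
  shows "(\<lambda>x\<in>X. \<Sum>a\<in>A. f a x) \<in> gen_algebra X K S"
  using assms(1,3)
proof (induction A)
  case empty
  show ?case using gen_algebra_const[OF assms(2), of X S] by (simp only: sum.empty)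
next
  case (insert a A)
  have "(\<lambda>x\<in>X. f a x + (\<Sum>a\<in>A. f a x)) \<in> gen_algebra X K S"
    by (rule gen_algebra_add[OF insert.prems[OF insertI1] insert.IH]) (rule insert.prems, erule insertI2)
  also have "(\<lambda>x\<in>X. f a x + (\<Sum>a\<in>A. f a x)) = (\<lambda>x\<in>X. \<Sum>a\<in>insert a A. f a x)"
    by (rule restrict_ext) (use insert.hyps in simp)
  finally show ?case .
qed

lemma gen_algebra_extensional:
  assumes "f \<in> gen_algebra X K S" "S \<subseteq> extensional X"
  shows "f \<in> extensional X"
proof -
  interpret cring "fun_ring X" by (rule cring_fun_ring)
  have "(\<lambda>c. \<lambda>x\<in>X. c) ` K \<union> S \<subseteq> carrier (fun_ring X)"
    using assms(2) by (auto simp: fun_ring_simps)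
  from generate_ring_in_carrier[OF this] assms(1) show ?thesis
    by (simp add: gen_algebra_def fun_ring_simps)
qed

lemma gen_algebra_poly:
  assumes "(\<lambda>x\<in>X. h x) \<in> gen_algebra X \<rat> S" "rat_poly p"
  shows "(\<lambda>x\<in>X. poly p (h x)) \<in> gen_algebra X \<rat> S"
proof -
  have "(\<lambda>x\<in>X. \<Sum>i\<le>degree p. Polynomial.coeff p i * h x ^ i) \<in> gen_algebra X \<rat> S"
    using assms
    by (intro gen_algebra_sum gen_algebra_mult gen_algebra_const gen_algebra_power)
      (auto simp: rat_poly_def)
  then show ?thesis by (simp only: poly_altdef)
qed

text \<open>Identifies the coefficient ring \<rat>[l] of \<open>module_basis\<close> with the
  coefficients used in \<open>in_span\<close>.\<close>

lemma gen_algebra_singleton: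
  "gen_algebra X \<rat> {\<lambda>x\<in>X. h x} = {\<lambda>x\<in>X. poly p (h x) | p. rat_poly p}"
proof (intro equalityI subsetI)
  fix f assume f: "f \<in> gen_algebra X \<rat> {\<lambda>x\<in>X. h x}"
  have "1 \<in> (\<rat> :: complex set)" "- 1 \<in> (\<rat> :: complex set)" by auto
  with f show "f \<in> {\<lambda>x\<in>X. poly p (h x) | p. rat_poly p}"
  proof (induction rule: gen_algebra_induct)
    case (const c)
    then have "(\<lambda>x\<in>X. c) = (\<lambda>x\<in>X. poly [:c:] (h x)) \<and> rat_poly [:c:]"
      by (auto simp: rat_poly_pCons rat_poly_0)
    then show ?case by blast
  next
    case (incl g)
    then have "g = (\<lambda>x\<in>X. poly [:0, 1:] (h x)) \<and> rat_poly [:0, 1:]"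
      by (auto simp: rat_poly_pCons rat_poly_0)
    then show ?case by blast
  next
    case (add f g)
    then obtain p q where "f = (\<lambda>x\<in>X. poly p (h x))" "g = (\<lambda>x\<in>X. poly q (h x))"
      "rat_poly p" "rat_poly q" by blast
    then have "(\<lambda>x\<in>X. f x + g x) = (\<lambda>x\<in>X. poly (p + q) (h x)) \<and> rat_poly (p + q)"
      by (auto simp: rat_poly_add)
    then show ?case by blast
  next
    case (mult f g)
    then obtain p q where "f = (\<lambda>x\<in>X. poly p (h x))" "g = (\<lambda>x\<in>X. poly q (h x))"
      "rat_poly p" "rat_poly q" by blast
    then have "(\<lambda>x\<in>X. f x * g x) = (\<lambda>x\<in>X. poly (p * q) (h x)) \<and> rat_poly (p * q)"
      by (auto simp: rat_poly_mult)
    then show ?case by blast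
  qed auto
next
  fix f assume "f \<in> {\<lambda>x\<in>X. poly p (h x) | p. rat_poly p}"
  then show "f \<in> gen_algebra X \<rat> {\<lambda>x\<in>X. h x}"
    using gen_algebra_poly[OF gen_algebra_incl[of "\<lambda>x\<in>X. h x" "{\<lambda>x\<in>X. h x}"]] by blast
qed

definition monom_fun :: "char_fun set \<Rightarrow> complex \<Rightarrow> nat \<times> nat \<times> nat \<Rightarrow> char_fun \<Rightarrow> complex" where
  "monom_fun X \<omega> i = (\<lambda>\<psi>\<in>X. curve_monom \<omega> i (zc \<psi>) (yc \<psi>))"

lemma monom_fun_independent:
  assumes \<omega>: "\<omega> * \<omega> = -1" and rat: "\<And>i. i \<in> exponents \<Longrightarrow> rat_poly (p i)"
    and zero: "\<And>\<psi>. \<psi> \<in> curve_chars \<omega> \<Longrightarrow>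
      (\<Sum>i\<in>exponents. poly (p i) (coord lambda_word \<psi>) * monom_fun (curve_chars \<omega>) \<omega> i \<psi>) = 0"
    and "m \<in> exponents"
  shows "p m = 0"
proof (rule curve_monom_independent[OF \<omega> rat _ \<open>m \<in> exponents\<close>])
  fix z y assume "on_V z y"
  then obtain \<psi> where \<psi>: "\<psi> \<in> curve_chars \<omega>" "zc \<psi> = z" "yc \<psi> = y"
    using curve_chars_surj[OF _ \<omega>] by metis
  then show "(\<Sum>i\<in>exponents. poly (p i) (lambda_trace z y) * curve_monom \<omega> i z y) = 0"
    using zero[OF \<psi>(1)] by (simp add: monom_fun_def coord_lambda[OF \<psi>(1)])
qed

text \<open>\<open>module_basis\<close> speaks of a set of functions, so a coefficient can be
  attached to an exponent only if different exponents give different functions. A coincidence would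
  be a linear relation with coefficients 1 and -1.\<close>

lemma inj_monom_fun:
  assumes \<omega>: "\<omega> * \<omega> = -1"
  shows "inj_on (monom_fun (curve_chars \<omega>) \<omega>) exponents"
proof (rule inj_onI, rule ccontr)
  fix m n assume mn: "m \<in> exponents" "n \<in> exponents" "monom_fun (curve_chars \<omega>) \<omega> m = monom_fun (curve_chars \<omega>) \<omega> n" "m \<noteq> n"
  define p where "p i = (if i = m then [:1:] else if i = n then [:-1:] else 0 :: complex poly)" for i
  have "(\<Sum>i\<in>exponents. poly (p i) (coord lambda_word \<psi>) * monom_fun (curve_chars \<omega>) \<omega> i \<psi>) = 0" for \<psi>
  proof -
    have "(\<Sum>i\<in>exponents. poly (p i) (coord lambda_word \<psi>) * monom_fun (curve_chars \<omega>) \<omega> i \<psi>)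
        = (\<Sum>i\<in>{m, n}. poly (p i) (coord lambda_word \<psi>) * monom_fun (curve_chars \<omega>) \<omega> i \<psi>)"
      using mn by (intro sum.mono_neutral_right) (auto simp: p_def)
    also have "\<dots> = 0" using mn by (simp add: p_def)
    finally show ?thesis .
  qed
  moreover have "rat_poly (p i)" for i
    by (simp add: p_def rat_poly_pCons rat_poly_0)
  ultimately have "p m = 0" using monom_fun_independent[OF \<omega>] mn(1) by blast
  then show False by (simp add: p_def)
qed

lemma monom_fun_basis:
  assumes \<omega>: "\<omega> * \<omega> = -1" and X: "X = curve_chars \<omega>"
  shows "module_basis (fun_ring X) (gen_algebra X \<rat> {\<lambda>\<psi>\<in>X. coord lambda_word \<psi>}) (T_Q X) (monom_fun X \<omega> ` exponents)"
proof -
  let ?K = "gen_algebra X \<rat> {\<lambda>\<psi>\<in>X. coord lambda_word \<psi>}" and ?b = "monom_fun X \<omega>"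
  have inj: "inj_on ?b exponents" using inj_monom_fun[OF \<omega>] by (simp add: X)
  have Keq: "?K = {\<lambda>\<psi>\<in>X. poly p (coord lambda_word \<psi>) | p. rat_poly p}"
    by (rule gen_algebra_singleton)
  have comb: "(\<Oplus>\<^bsub>fun_ring X\<^esub>b\<in>A. c b \<otimes>\<^bsub>fun_ring X\<^esub> b) = (\<lambda>\<psi>\<in>X. \<Sum>b\<in>A. c b \<psi> * b \<psi>)"
    if "finite A" for A c
    using finsum_fun_ring[OF that, of X "\<lambda>b \<psi>. c b \<psi> * b \<psi>"] by (simp only: fun_ring_simps)
  have gens: "Ifun X ` carrier piN \<subseteq> extensional X"
    by (auto simp: Ifun_def)
  have coord: "(\<lambda>\<psi>\<in>X. coord w \<psi>) \<in> T_Q X" for w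
    unfolding T_Q_def by (rule coord_in_gen_algebra)
  have tau: "coord wt \<psi> = \<omega> * (zc \<psi>)\<^sup>2 / 2" if "\<psi> \<in> X" for \<psi>
    using that by (simp add: X curve_chars_iff)
  have curve_monom: "(\<lambda>\<psi>\<in>X. curve_monom \<omega> i (zc \<psi>) (yc \<psi>)) \<in> T_Q X" for i
  proof -
    obtain k n j where i: "i = (k, n, j)" by (cases i)
    have "(\<lambda>\<psi>\<in>X. coord wt \<psi> ^ k * zc \<psi> ^ n * yc \<psi> ^ j) \<in> T_Q X"
      unfolding T_Q_def by (intro gen_algebra_mult gen_algebra_power coord_in_gen_algebra) auto
    also have "(\<lambda>\<psi>\<in>X. coord wt \<psi> ^ k * zc \<psi> ^ n * yc \<psi> ^ j) = (\<lambda>\<psi>\<in>X. curve_monom \<omega> i (zc \<psi>) (yc \<psi>))"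
      by (rule restrict_ext) (simp add: tau curve_monom_def i)
    finally show ?thesis .
  qed
  have "?b ` exponents \<subseteq> T_Q X" using curve_monom by (auto simp: monom_fun_def)
  moreover have "T_Q X = {\<Oplus>\<^bsub>fun_ring X\<^esub>b\<in>A. c b \<otimes>\<^bsub>fun_ring X\<^esub> b | A c.
      finite A \<and> A \<subseteq> ?b ` exponents \<and> c \<in> A \<rightarrow> ?K}" (is "_ = ?span")
  proof (intro equalityI subsetI)
    fix f assume f: "f \<in> T_Q X"
    obtain g where g: "polyfun (insert \<omega> \<rat>) g" "\<And>\<psi>. \<psi> \<in> X \<Longrightarrow> f \<psi> = g (zc \<psi>) (yc \<psi>)"
      using gen_algebra_polyfun[OF f[unfolded T_Q_def], of \<omega>] by (auto simp: X)
    obtain p where p: "\<And>i. i \<in> exponents \<Longrightarrow> rat_poly (p i)"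
      "\<And>z y. on_V z y \<Longrightarrow> g z y = (\<Sum>i\<in>exponents. poly (p i) (lambda_trace z y) * curve_monom \<omega> i z y)"
      using polyfun_in_span[OF \<omega> g(1)] unfolding in_span_def by blast
    \<comment> \<open>Coefficients are transported from exponents to functions along the inverse of
      the injection \<open>?b\<close>.\<close>
    define c where "c b = (\<lambda>\<psi>\<in>X. poly (p (the_inv_into exponents ?b b)) (coord lambda_word \<psi>))" for b
    have cb: "c (?b i) = (\<lambda>\<psi>\<in>X. poly (p i) (coord lambda_word \<psi>))" if "i \<in> exponents" for i
      using that by (simp add: c_def the_inv_into_f_f[OF inj])
    have "f = (\<lambda>\<psi>\<in>X. \<Sum>b\<in>?b ` exponents. c b \<psi> * b \<psi>)"
    proof (rule extensionalityI)
      show "f \<in> extensional X"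
        by (rule gen_algebra_extensional[OF f[unfolded T_Q_def] gens])
      fix \<psi> assume \<psi>: "\<psi> \<in> X"
      then have lam: "lambda_trace (zc \<psi>) (yc \<psi>) = coord lambda_word \<psi>"
        using coord_lambda[of \<psi> \<omega>] by (simp add: X)
      have "on_V (zc \<psi>) (yc \<psi>)" using \<psi> by (simp add: X curve_chars_iff)
      then have "f \<psi> = (\<Sum>i\<in>exponents. poly (p i) (lambda_trace (zc \<psi>) (yc \<psi>)) * curve_monom \<omega> i (zc \<psi>) (yc \<psi>))"
        using g(2)[OF \<psi>] p(2) by simp
      also have "\<dots> = (\<Sum>i\<in>exponents. c (?b i) \<psi> * ?b i \<psi>)"
        by (rule sum.cong[OF HOL.refl]) (simp only: cb lam restrict_apply' \<psi>, simp add: monom_fun_def \<psi>)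
      also have "\<dots> = (\<Sum>b\<in>?b ` exponents. c b \<psi> * b \<psi>)"
        by (simp add: sum.reindex[OF inj])
      finally show "f \<psi> = (\<lambda>\<psi>\<in>X. \<Sum>b\<in>?b ` exponents. c b \<psi> * b \<psi>) \<psi>"
        using \<psi> by simp
    qed (rule restrict_extensional)
    also have "\<dots> = (\<Oplus>\<^bsub>fun_ring X\<^esub>b\<in>?b ` exponents. c b \<otimes>\<^bsub>fun_ring X\<^esub> b)"
      by (rule comb[symmetric]) simp
    finally have "f = (\<Oplus>\<^bsub>fun_ring X\<^esub>b\<in>?b ` exponents. c b \<otimes>\<^bsub>fun_ring X\<^esub> b)" .
    moreover have "c \<in> ?b ` exponents \<rightarrow> ?K"
      unfolding Keq using cb p(1) by blast
    ultimately show "f \<in> ?span"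
      using finite_imageI[OF finite_exponents, of ?b] by blast
  next
    fix f assume "f \<in> ?span"
    then obtain A c where A: "finite A" "A \<subseteq> ?b ` exponents" "c \<in> A \<rightarrow> ?K"
      and f: "f = (\<Oplus>\<^bsub>fun_ring X\<^esub>b\<in>A. c b \<otimes>\<^bsub>fun_ring X\<^esub> b)" by blast
    have "(\<lambda>\<psi>\<in>X. c b \<psi> * b \<psi>) \<in> T_Q X" if "b \<in> A" for b
    proof -
      obtain i where i: "b = ?b i" using A(2) \<open>b \<in> A\<close> by blast
      obtain p where p: "c b = (\<lambda>\<psi>\<in>X. poly p (coord lambda_word \<psi>))" "rat_poly p"
        using A(3) \<open>b \<in> A\<close> unfolding Keq by blast
      have "(\<lambda>\<psi>\<in>X. poly p (coord lambda_word \<psi>) * curve_monom \<omega> i (zc \<psi>) (yc \<psi>)) \<in> T_Q X"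
        using gen_algebra_mult[OF gen_algebra_poly[OF coord_in_gen_algebra p(2)] curve_monom[unfolded T_Q_def]]
        by (simp only: T_Q_def)
      also have "(\<lambda>\<psi>\<in>X. poly p (coord lambda_word \<psi>) * curve_monom \<omega> i (zc \<psi>) (yc \<psi>)) = (\<lambda>\<psi>\<in>X. c b \<psi> * b \<psi>)"
        by (rule restrict_ext) (simp add: i[symmetric] p(1), simp add: i monom_fun_def)
      finally show ?thesis .
    qed
    then show "f \<in> T_Q X"
      unfolding f comb[OF A(1)] T_Q_def using A(1) by (intro gen_algebra_sum) auto
  qed
  moreover have "\<forall>b\<in>A. c b = \<zero>\<^bsub>fun_ring X\<^esub>"
    if A: "finite A" "A \<subseteq> ?b ` exponents" "c \<in> A \<rightarrow> ?K"
      and zero: "(\<Oplus>\<^bsub>fun_ring X\<^esub>b\<in>A. c b \<otimes>\<^bsub>fun_ring X\<^esub> b) = \<zero>\<^bsub>fun_ring X\<^esub>" for A c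
  proof -
    \<comment> \<open>A relation over a finite subset \<open>A\<close> is extended to all exponents
      with coefficient 0 outside \<open>A\<close>.\<close>
    have "\<forall>i. \<exists>p. rat_poly p \<and> (?b i \<in> A \<longrightarrow> c (?b i) = (\<lambda>\<psi>\<in>X. poly p (coord lambda_word \<psi>)))
        \<and> (?b i \<notin> A \<longrightarrow> p = 0)"
      using A(3) rat_poly_0 unfolding Keq by blast
    then obtain p where p: "\<And>i. rat_poly (p i)"
      "\<And>i. ?b i \<in> A \<Longrightarrow> c (?b i) = (\<lambda>\<psi>\<in>X. poly (p i) (coord lambda_word \<psi>))"
      "\<And>i. ?b i \<notin> A \<Longrightarrow> p i = 0" by metis
    have vanish: "(\<Sum>i\<in>exponents. poly (p i) (coord lambda_word \<psi>) * ?b i \<psi>) = 0" if \<psi>: "\<psi> \<in> X" for \<psi>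
    proof -
      have "(\<Sum>i\<in>exponents. poly (p i) (coord lambda_word \<psi>) * ?b i \<psi>)
          = (\<Sum>i\<in>{i \<in> exponents. ?b i \<in> A}. c (?b i) \<psi> * ?b i \<psi>)"
        using \<psi> p(2,3) by (intro sum.mono_neutral_cong_right) auto
      also have "\<dots> = (\<Sum>b\<in>?b ` {i \<in> exponents. ?b i \<in> A}. c b \<psi> * b \<psi>)"
        by (subst sum.reindex) (auto intro: inj_on_subset[OF inj])
      also have "?b ` {i \<in> exponents. ?b i \<in> A} = A" using A(2) by auto
      also have "(\<Sum>b\<in>A. c b \<psi> * b \<psi>) = 0"
        using fun_cong[OF zero[unfolded comb[OF A(1)]], of \<psi>] \<psi> by (simp add: fun_ring_simps)
      finally show ?thesis .
    qed
    have p0: "p i = 0" if "i \<in> exponents" for i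
      by (rule monom_fun_independent[OF \<omega> p(1) vanish[unfolded X] that])
    show ?thesis
    proof
      fix b assume "b \<in> A"
      then obtain i where i: "i \<in> exponents" "b = ?b i" using A(2) by blast
      then have "c b = (\<lambda>\<psi>\<in>X. poly (p i) (coord lambda_word \<psi>))"
        using p(2) \<open>b \<in> A\<close> by blast
      then show "c b = \<zero>\<^bsub>fun_ring X\<^esub>"
        by (simp only: p0[OF i(1)] poly_0 fun_ring_simps)
    qed
  qed
  ultimately show ?thesis unfolding module_basis_def by blast
qed

lemma fun_ring_nat_pow: "f [^]\<^bsub>fun_ring X\<^esub> (n::nat) = (\<lambda>x\<in>X. f x ^ n)"
proof -
  interpret cring "fun_ring X" by (rule cring_fun_ring)
  show ?thesis
  proof (induction n)
    case 0
    show ?case by (simp only: nat_pow_0 fun_ring_simps power_0)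
  next
    case (Suc n)
    have "f [^]\<^bsub>fun_ring X\<^esub> Suc n = (\<lambda>x\<in>X. (\<lambda>x\<in>X. f x ^ n) x * f x)"
      by (simp only: nat_pow_Suc Suc fun_ring_simps)
    also have "\<dots> = (\<lambda>x\<in>X. f x ^ Suc n)" by (rule restrict_ext) (simp only: restrict_apply' power_Suc mult.commute)
    finally show ?case .
  qed
qed

theorem lemma7p14:
  fixes X :: "char_fun set" and R (structure)
  assumes "hyperbolic_curve X"
  defines "R \<equiv> fun_ring X"
  defines "l \<equiv> Ifun X lamN"
  defines "t \<equiv> Ifun X \<tau>N"
  defines "y \<equiv> Ifun X \<beta>N"
  defines "z \<equiv> Ifun X (\<alpha>N \<otimes>\<^bsub>piN\<^esub> \<beta>N)"
  defines "B_C \<equiv> {\<one>, z, z [^] (2::nat), z [^] (3::nat),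
                  y, z \<otimes> y, z [^] (2::nat) \<otimes> y, z [^] (3::nat) \<otimes> y}"
  defines "B_Q \<equiv> B_C \<union> (\<lambda>b. t \<otimes> b) ` B_C"
  shows "module_basis R (gen_algebra X \<rat> {l}) (T_Q X) B_Q"
proof -
  obtain \<omega> where \<omega>: "\<omega> * \<omega> = -1" and X: "X = curve_chars \<omega>"
    using hyperbolic_curve_eq[OF assms(1)] .
  have mult: "word_class relN u \<otimes>\<^bsub>piN\<^esub> word_class relN v = word_class relN (u @ v)" for u v
    by (simp add: piN_def presented_group_mult)
  have l: "l = (\<lambda>\<psi>\<in>X. coord lambda_word \<psi>)"
    unfolding l_def lamN_def lambda_word_def \<alpha>N_def \<beta>N_def by (simp only: mult inv_word_class Ifun_word append_assoc)
  have z: "z = (\<lambda>\<psi>\<in>X. zc \<psi>)" and y: "y = (\<lambda>\<psi>\<in>X. yc \<psi>)" and t: "t = (\<lambda>\<psi>\<in>X. coord wt \<psi>)"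
    unfolding z_def y_def t_def \<alpha>N_def \<beta>N_def \<tau>N_def by (simp_all only: mult Ifun_word)
  let ?m = "monom_fun X \<omega>"
  have tau: "coord wt \<psi> = \<omega> * (zc \<psi>)\<^sup>2 / 2" if "\<psi> \<in> X" for \<psi>
    using that by (simp add: X curve_chars_iff)
  have one: "\<one> = ?m (0, 0, 0)" "z = ?m (0, 1, 0)" "y = ?m (0, 0, 1)" "z \<otimes> y = ?m (0, 1, 1)"
    unfolding R_def monom_fun_def fun_ring_simps z y
    by (rule restrict_ext, simp add: curve_monom_def)+
  have pow: "z [^] n = ?m (0, n, 0)" "z [^] n \<otimes> y = ?m (0, n, 1)" for n :: nat
    unfolding R_def monom_fun_def fun_ring_simps fun_ring_nat_pow z y
    by (rule restrict_ext, simp add: curve_monom_def)+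
  have tm: "t \<otimes> ?m (0, n, j) = ?m (1, n, j)" for n j
    unfolding R_def monom_fun_def t fun_ring_simps
    by (rule restrict_ext) (simp add: curve_monom_def tau)
  have BC: "B_C = ?m ` ({0} \<times> {0,1,2,3} \<times> {0,1})"
    \<comment> \<open>The order matters: compound terms are replaced first, because rewriting
      \<open>z\<close> or \<open>y\<close> alone would destroy their patterns.\<close>
    unfolding B_C_def unfolding pow(2) unfolding pow(1) unfolding one(4) unfolding one(1-3) by auto
  have "(\<lambda>b. t \<otimes> b) ` B_C = (\<lambda>i. ?m (1, snd i)) ` ({0::nat} \<times> {0,1,2,3} \<times> {0,1})"
    unfolding BC image_image by (rule image_cong[OF HOL.refl]) (auto simp: tm)
  also have "\<dots> = ?m ` ({1} \<times> {0,1,2,3} \<times> {0,1})"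
    by (auto simp: image_iff)
  finally have "B_Q = ?m ` ({0} \<times> {0,1,2,3} \<times> {0,1} \<union> {1} \<times> {0,1,2,3} \<times> {0,1})"
    unfolding B_Q_def by (simp only: BC image_Un)
  also have "{0} \<times> {0,1,2,3} \<times> {0,1} \<union> {1} \<times> {0,1,2,3} \<times> {0,1} = exponents"
  proof -
    have "{..<4::nat} = {0,1,2,3}" "{..<2::nat} = {0,1}" by auto
    then show ?thesis unfolding exponents_def by blast
  qed
  finally have "B_Q = ?m ` exponents" .
  then show ?thesis
    using monom_fun_basis[OF \<omega> X] by (simp only: l R_def)
qed

end
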